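(* Let $C$ be a closed convex cone in $H$, $K$ a nonempty closed convex subset of $C$ with $K^\infty$ pointed, and let $f:C\to H$ and $g:H\to H$ be weakly homogeneous mappings of degrees $\delta_1>0$ and $\delta_2>0$, respectively, written $f=f^\infty+\bar f+p$ and $g=g^\infty+\bar g+q$. Let $F,F^\infty:H\to H$ be any given continuous extensions of $f^\infty+\bar f-\bar f(0)$ and $f^\infty$, respectively. Suppose that $g^{-1}(C)\subseteq C$, that $\bar g(x)+q\in C$ as $\|x\|\to\infty$ (i.e. for all $x\in H$ with $\|x\|$ sufficiently large), and that there exists a vector $d\in\mathrm{int}((K^\infty)^* )$ such that one of the following conditions holds: (a) SOL$(f^\infty,g^\infty,K^\infty)=\{0\}=$ SOL$(f^\infty+\bar f-\bar f(0)+d,\,g,\,K^\infty)$, and there exists a nonempty bounded open set $\Omega\subset H$ satisfying $\mathrm{dist}(F(x),g(x))<\mathrm{dist}(d,\partial((K^\infty)^* ))$ for all $x\in\Omega$, such that $\deg(g,\Omega,0)\ne0$; (b) SOL$(f^\infty,g^\infty,K^\infty)=\{0\}=$ SOL$(f^\infty+d,\,g^\infty,\,K^\infty)$, and there exists a nonempty bounded open set $\Omega\subset H$ satisfying $\mathrm{dist}(F^\infty(x),g^\infty(x))<\mathrm{dist}(d,\partial((K^\infty)^* ))$ for all $x\in\Omega$, such that $\deg(g^\infty,\Omega,0)\ne0$. If additionally $f$ is strictly monotone with respect to $g$ on $K$, then WHGVI$(f,g,K)$ has a unique solution. If additionally $f$ is strictly monotone with respect to $g$ on $K^\infty$, then WHGCP$(f,g,K^\infty)$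 has a unique solution.
   Context: $H$ is a finite dimensional real Hilbert space with inner product $\langle\cdot,\cdot\rangle$ and norm $\|\cdot\|$; $\mathrm{dist}(u,v)=\|u-v\|$ for points and $\mathrm{dist}(d,S)=\inf_{s\in S}\|d-s\|$ for a set $S$ (equal to $+\infty$ if $S=\emptyset$); $\mathrm{int}$ and $\partial$ denote interior and boundary; $g^{-1}(C)=\{x\in H\mid g(x)\in C\}$; the dual cone of $S$ is $S^*=\{u\in H\mid \langle u,x\rangle\ge0\ \forall x\in S\}$; the recession cone of $K$ is $K^\infty:=\{u\in H\mid \exists t_k\to\infty,\ \exists x^k\in K \text{ such that } x^k/t_k\to u\}$. Weakly homogeneous mappings: let $D\subseteq H$ be a closed convex cone ($D=C$ for $f$, $D=H$ for $g$). A continuous $h:D\to H$ is positively homogeneous of degree $\delta$ if $h(\lambda x)=\lambda^\delta h(x)$ for all $x\in D$, $\lambda>0$. A mapping $\varphi:D\to H$ is weakly homogeneous of degree $\delta>0$ if $\varphi=h+e$ with $h$ positively homogeneous of degree $\delta$ and $e:D\to H$ continuous with $e(x)/\|x\|^\delta\to0$ as $\|x\|\to\infty$ in $D$; $h$ is unique, is called the leading term and is denoted $\varphi^\infty$. In $f=f^\infty+\bar f+p$, $p\in H$ is the constant item and $\bar f:=f-f^\infty-p$; likewise $q\in H$ and $\bar g:=g-g^\infty-q$. Thus $\bar g+q=g-g^\infty$ and $f^\infty+\bar f-\bar f(0)=f-f(0)$. For mappings $\phi$ (on $C$ or $H$), $\psi:H\to H$ and closed convex $S$, SOL$(\phi,\psi,S)$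 is the set of $x$ such that $\psi(x)\in S$ and $\langle\phi(x),y-\psi(x)\rangle\ge0$ for all $y\in S$; if $S$ is a cone this is equivalent to $\psi(x)\in S$, $\phi(x)\in S^*$, $\langle\phi(x),\psi(x)\rangle=0$. WHGVI$(f,g,K)$ is the problem with solution set SOL$(f,g,K)$, and WHGCP$(f,g,K^\infty)$ is the problem of finding $x\in H$ with $g(x)\in K^\infty$, $f(x)\in(K^\infty)^*$, $\langle f(x),g(x)\rangle=0$. $f$ is strictly monotone with respect to $g$ on $S$ if $g(x),g(y)\in S$ and $x\ne y$ imply $\langle f(x)-f(y),g(x)-g(y)\rangle>0$. $\deg(\phi,\Omega,b)$ is the topological (Brouwer) degree, defined when $\Omega$ is bounded open, $\phi$ is continuous on $\bar\Omega$ and $b\notin\phi(\partial\Omega)$; writing $\deg(\cdot)\ne0$ includes that it is defined. *)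

theory Defs
  imports "HOL-Analysis.Analysis" "HOL-Homology.Homology"
begin

definition dual_cone :: "'a::real_inner set \<Rightarrow> 'a set"
  where "dual_cone S = {u. \<forall>x\<in>S. 0 \<le> inner u x}"

definition recession_cone :: "'a::real_normed_vector set \<Rightarrow> 'a set"
  where "recession_cone K =
    {u. \<exists>(t::nat \<Rightarrow> real) x. filterlim t at_top sequentially \<and> (\<forall>k. x k \<in> K) \<and>
          (\<lambda>k. x k /\<^sub>R t k) \<longlonglongrightarrow> u}"

definition pointed :: "'a::real_vector set \<Rightarrow> bool"
  where "pointed S \<longleftrightarrow> S \<inter> uminus ` S = {0}"

text \<open>Point-to-set distance with value \<open>\<infinity>\<close> for the empty set (the library's
  \<^const>\<open>infdist\<close> and \<^const>\<open>setdist\<close> give \<open>0\<close> there). The empty case does occur: if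
  \<open>recession_cone K = {0}\<close>, its dual cone is the whole space and has empty frontier.\<close>

definition edist_to_set :: "'a::metric_space \<Rightarrow> 'a set \<Rightarrow> ereal"
  where "edist_to_set d S = (INF s\<in>S. ereal (dist d s))"

text \<open>A mapping with domain \<open>D\<close> is a total HOL function of which only the values on \<open>D\<close>
  are used.\<close>

definition pos_homogeneous :: "'a::real_normed_vector set \<Rightarrow> real \<Rightarrow> ('a \<Rightarrow> 'a) \<Rightarrow> bool"
  where "pos_homogeneous D \<delta> h \<longleftrightarrow>
    continuous_on D h \<and> (\<forall>x\<in>D. \<forall>t>0. h (t *\<^sub>R x) = (t powr \<delta>) *\<^sub>R h x)"

text \<open>\<open>weakly_homogeneous D \<delta> \<phi> h\<close>: \<open>\<phi>\<close> is weakly homogeneous of degree \<open>\<delta>\<close> on \<open>D\<close> with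
  leading term \<open>h\<close>; on \<open>D\<close> such an \<open>h\<close> is unique.\<close>

definition weakly_homogeneous ::
    "'a::real_normed_vector set \<Rightarrow> real \<Rightarrow> ('a \<Rightarrow> 'a) \<Rightarrow> ('a \<Rightarrow> 'a) \<Rightarrow> bool"
  where "weakly_homogeneous D \<delta> \<phi> h \<longleftrightarrow>
    \<delta> > 0 \<and> pos_homogeneous D \<delta> h \<and>
    (\<exists>e. continuous_on D e \<and> (\<forall>x\<in>D. \<phi> x = h x + e x) \<and>
         tendsto (\<lambda>x. e x /\<^sub>R (norm x powr \<delta>)) 0 (inf at_infinity (principal D)))"

text \<open>Solution sets; \<open>D\<close> is the domain of the first mapping.\<close>

definition SOL :: "'a::real_inner set \<Rightarrow> ('a \<Rightarrow> 'a) \<Rightarrow> ('a \<Rightarrow> 'a) \<Rightarrow> 'a set \<Rightarrow> 'a set"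
  where "SOL D \<phi> \<psi> S = {x\<in>D. \<psi> x \<in> S \<and> (\<forall>y\<in>S. 0 \<le> inner (\<phi> x) (y - \<psi> x))}"

definition GCP_SOL :: "'a::real_inner set \<Rightarrow> ('a \<Rightarrow> 'a) \<Rightarrow> ('a \<Rightarrow> 'a) \<Rightarrow> 'a set \<Rightarrow> 'a set"
  where "GCP_SOL D \<phi> \<psi> S = {x\<in>D. \<psi> x \<in> S \<and> \<phi> x \<in> dual_cone S \<and> inner (\<phi> x) (\<psi> x) = 0}"

definition strictly_monotone_wrt ::
    "'a::real_inner set \<Rightarrow> ('a \<Rightarrow> 'a) \<Rightarrow> ('a \<Rightarrow> 'a) \<Rightarrow> 'a set \<Rightarrow> bool"
  where "strictly_monotone_wrt D f g S \<longleftrightarrow>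
    (\<forall>x\<in>D. \<forall>y\<in>D. g x \<in> S \<and> g y \<in> S \<and> x \<noteq> y \<longrightarrow> inner (f x - f y) (g x - g y) > 0)"

definition brouwer_degree_defined :: "('a::euclidean_space \<Rightarrow> 'a) \<Rightarrow> 'a set \<Rightarrow> 'a \<Rightarrow> bool"
  where "brouwer_degree_defined \<phi> \<Omega> b \<longleftrightarrow>
    bounded \<Omega> \<and> open \<Omega> \<and> continuous_on (closure \<Omega>) \<phi> \<and> b \<notin> \<phi> ` frontier \<Omega>"

text \<open>The Brouwer degree in its homological form (Dold, Lectures on Algebraic Topology,
  Ch. IV.5). Let \<open>n\<close> be the dimension, \<open>E\<close> the space, \<open>Z = {x \<in> \<Omega>. \<phi> x = b}\<close>, which is compact
  when the degree is defined, and let \<open>B\<close> be a closed ball around \<open>0\<close> containing \<open>\<Omega>\<close> and \<open>b\<close>.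
  In
  \<open>H\<^sub>n(E, E - B) \<rightarrow> H\<^sub>n(E, E - Z) \<leftarrow> H\<^sub>n(\<Omega>, \<Omega> - Z) \<rightarrow> H\<^sub>n(E, E - {b})\<close>
  the first two maps are induced by inclusions, the second one being an excision isomorphism,
  and the third is induced by \<open>\<phi>\<close>. The inclusion also induces an isomorphism
  \<open>H\<^sub>n(E, E - B) \<rightarrow> H\<^sub>n(E, E - {b})\<close> of infinite cyclic groups, and the degree is
  the integer by which the composite differs from it; no orientation has to be chosen.
  Homology groups are written multiplicatively in the library.\<close>

definition is_brouwer_degree :: "('a::euclidean_space \<Rightarrow> 'a) \<Rightarrow> 'a set \<Rightarrow> 'a \<Rightarrow> int \<Rightarrow> bool"
  where "is_brouwer_degree \<phi> \<Omega> b k \<longleftrightarrow>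
    (let n = int DIM('a); Z = {x\<in>\<Omega>. \<phi> x = b} in
     \<forall>r. \<Omega> \<union> {b} \<subseteq> cball 0 r \<longrightarrow>
      (\<forall>x \<in> carrier (relative_homology_group n euclidean (- cball 0 r)).
       \<forall>y \<in> carrier (relative_homology_group n (top_of_set \<Omega>) (\<Omega> - Z)).
         hom_induced n (top_of_set \<Omega>) (\<Omega> - Z) euclidean (- Z) id y
           = hom_induced n euclidean (- cball 0 r) euclidean (- Z) id x \<longrightarrow>
         hom_induced n (top_of_set \<Omega>) (\<Omega> - Z) euclidean (- {b}) \<phi> y
           = hom_induced n euclidean (- cball 0 r) euclidean (- {b}) id x
               [^]\<^bsub>relative_homology_group n euclidean (- {b})\<^esub> k))"

definition brouwer_degree :: "('a::euclidean_space \<Rightarrow> 'a) \<Rightarrow> 'a set \<Rightarrow> 'a \<Rightarrow> int"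
  where "brouwer_degree \<phi> \<Omega> b = (THE k. is_brouwer_degree \<phi> \<Omega> b k)"

text \<open>Whenever the degree is defined, the number in the definition exists and is unique
  (\<open>brouwer_degree_ex1\<close>); moreover the identity has degree \<open>1\<close>, and the degree vanishes
  if \<open>\<phi> x = b\<close> has no solution in \<open>\<Omega>\<close>.\<close>

lemma homology_punctured_space:
  fixes b :: "'a::euclidean_space"
  shows "relative_homology_group (int DIM('a)) (euclidean::'a topology) (- {b}) \<cong> integer_group"
proof -
  have "relative_homology_group (int DIM('a)) (euclidean::'a topology) (- {b})
      \<cong> reduced_homology_group (int DIM('a) - 1) (top_of_set (- {b}))"
  proof (rule isomorphic_group_relative_homology_of_contractible)
    have "contractible (UNIV::'a set)" by (rule convex_imp_contractible) simp
    then show "contractible_space (euclidean::'a topology)"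
      using contractible_space_top_of_set[of "UNIV::'a set"] by simp
    have "b + (SOME i. i \<in> Basis) \<noteq> b"
      using nonzero_Basis some_in_eq nonempty_Basis by (metis add_cancel_right_right)
    then show "topspace (euclidean::'a topology) \<inter> - {b} \<noteq> {}"
      by (metis ComplI IntI UNIV_I empty_iff singletonD topspace_euclidean)
  qed
  moreover have "reduced_homology_group (int DIM('a) - 1) (top_of_set (- {b}))
      \<cong> reduced_homology_group (int DIM('a) - 1) (top_of_set (sphere b 1))"
  proof (rule homotopy_equivalent_space_imp_isomorphic_reduced_homology_groups)
    have "rel_frontier (cball b 1) homotopy_eqv (affine hull (cball b 1) - {b})"
      by (rule homotopy_eqv_rel_frontier_punctured_affine_hull) (auto intro: subsetD[OF interior_subset_rel_interior])
    moreover have "affine hull (cball b 1) = UNIV"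
      by (rule affine_hull_nonempty_interior) auto
    ultimately have "sphere b 1 homotopy_eqv (- {b})"
      by (simp add: Compl_eq_Diff_UNIV)
    then show "(- {b}) homotopy_eqv sphere b 1"
      by (rule homotopy_equivalent_space_sym[THEN iffD1])
  qed
  moreover have "reduced_homology_group (int DIM('a) - 1) (top_of_set (sphere b 1))
      \<cong> reduced_homology_group (int DIM('a) - 1) (nsphere (DIM('a) - 1))"
  proof (rule homeomorphic_space_imp_isomorphic_reduced_homology_groups)
    obtain f :: "(nat \<Rightarrow> real) \<Rightarrow> 'a" and g where
      "homeomorphic_maps (nsphere(DIM('a) - 1)) (top_of_set (sphere 0 1 \<inter> span Basis)) f g"
      using homeomorphic_maps_nsphere_euclidean_sphere[of "Basis::'a set" "DIM('a)"]
      by (auto simp: independent_Basis pairwise_def orthogonal_Basis orthogonal_def inner_Basis)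
    then have "nsphere (DIM('a) - 1) homeomorphic_space top_of_set (sphere (0::'a) 1)"
      by (auto simp: homeomorphic_space_def)
    moreover have "top_of_set (sphere (0::'a) 1) homeomorphic_space top_of_set (sphere b 1)"
      using homeomorphic_spheres[of 1 1 "0::'a" b] by simp
    ultimately show "top_of_set (sphere b 1) homeomorphic_space nsphere (DIM('a) - 1)"
      using homeomorphic_space_sym homeomorphic_space_trans by blast
  qed
  moreover have "reduced_homology_group (int DIM('a) - 1) (nsphere (DIM('a) - 1)) \<cong> integer_group"
    using reduced_homology_group_nsphere(1)[of "DIM('a) - 1"] by (simp add: of_nat_diff Suc_leI)
  ultimately show ?thesis
    by (rule iso_trans[OF iso_trans[OF iso_trans]])
qed

lemma iso_complement_cball_punctured:
  fixes b :: "'a::euclidean_space"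
  assumes b: "b \<in> cball 0 r"
  shows "hom_induced p euclidean (- cball 0 r) euclidean (- {b}) id
    \<in> iso (relative_homology_group p euclidean (- cball 0 r)) (relative_homology_group p euclidean (- {b}))"
proof -
  define R where "R = norm b + r + 1"
  define h where "h = (\<lambda>t::real. \<lambda>x. x + (t * R) *\<^sub>R sgn (x - b))"
  have r0: "r \<ge> 0" using b by (auto intro: order_trans[OF norm_ge_zero])
  have sgn: "(x - b) = norm (x - b) *\<^sub>R sgn (x - b)" for x by (cases "x = b") (auto simp: sgn_div_norm)
  have eq: "h t x = b + (norm (x-b) + t * R) *\<^sub>R sgn (x-b)" for t x
    using sgn[of x] by (simp add: h_def algebra_simps)
  have nb: "h t x \<noteq> b" if "0 \<le> t" "x \<noteq> b" for t x
  proof -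
    have "norm (x-b) + t * R > 0" using that r0 by (simp add: R_def add_pos_nonneg)
    then show ?thesis using that by (simp add: eq sgn_zero_iff)
  qed
  have out: "h t x \<notin> cball 0 r" if t: "0 \<le> t" and x: "x \<notin> cball 0 r" for t x
  proof
    assume "h t x \<in> cball 0 r"
    have xb: "x \<noteq> b" using x b by auto
    let ?s = "norm (x-b)"
    have s: "?s > 0" using xb by simp
    let ?c = "?s / (?s + t*R)"
    have tR: "t * R \<ge> 0" using t r0 by (simp add: R_def)
    have c: "0 \<le> ?c" "?c \<le> 1" using s tR by (auto simp: divide_le_eq_1 add_pos_nonneg)
    have "x = (1 - ?c) *\<^sub>R b + ?c *\<^sub>R h t x"
    proof -
      have "(1 - ?c) *\<^sub>R b + ?c *\<^sub>R h t x = b + (?c * (?s + t*R)) *\<^sub>R sgn (x-b)"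
        unfolding eq by (simp add: scaleR_add_right scaleR_left_diff_distrib)
      also have "?c * (?s + t*R) = ?s" using s tR by (metis add_pos_nonneg less_irrefl nonzero_eq_divide_eq)
      finally show ?thesis using sgn[of x] by simp
    qed
    moreover have "(1 - ?c) *\<^sub>R b + ?c *\<^sub>R h t x \<in> cball 0 r"
      using convexD[OF convex_cball b \<open>h t x \<in> cball 0 r\<close>] c by auto
    ultimately show False using x by metis
  qed
  have one: "h 1 x \<notin> cball 0 r" if "x \<noteq> b" for x
  proof -
    have "norm (h 1 x - b) = norm (x-b) + R"
      using that r0 by (simp add: eq norm_sgn R_def)
    then have "norm (h 1 x) + norm b \<ge> norm (x-b) + R" by (metis norm_triangle_ineq4)
    then show ?thesis using that by (auto simp: R_def) (smt (verit) norm_ge_zero)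
  qed
  have cont: "continuous_on ({0..1} \<times> (- {b})) (\<lambda>z. h (fst z) (snd z))"
    unfolding h_def sgn_div_norm by (intro continuous_intros) auto
  have triv: "trivial_group (relative_homology_group q (top_of_set (- {b})) (- cball 0 r))" for q
  proof (rule trivial_relative_homology_group_gen[where f = "h 1"])
    have sub: "- {b} \<inter> - cball 0 r = - cball 0 r" using b by auto
    have c1: "continuous_on (- {b}) (h 1)"
      unfolding h_def sgn_div_norm by (intro continuous_intros) auto
    show "continuous_map (top_of_set (- {b})) (subtopology (top_of_set (- {b})) (- cball 0 r)) (h 1)"
      unfolding subtopology_subtopology sub continuous_map_subtopology_eu using c1 one by auto
    have id: "h 0 = id" by (auto simp: h_def)
    have hw: "homotopic_with (\<lambda>h. True) (top_of_set S) (top_of_set S) (h 0) (h 1)"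
      if "S \<subseteq> - {b}" "\<And>t x. 0 \<le> t \<Longrightarrow> x \<in> S \<Longrightarrow> h t x \<in> S" for S
      unfolding homotopic_with_def
      by (rule exI[where x = "\<lambda>z. h (fst z) (snd z)"])
         (use that in \<open>auto intro!: continuous_on_subset[OF cont]
            simp: prod_topology_subtopology_eu continuous_map_subtopology_eu\<close>)
    show "homotopic_with (\<lambda>h. True) (subtopology (top_of_set (- {b})) (- cball 0 r)) (subtopology (top_of_set (- {b})) (- cball 0 r)) (h 1) id"
      using hw[of "- cball 0 r"] out b
      unfolding subtopology_subtopology sub id by (auto intro!: homotopic_with_symD)
    show "homotopic_with (\<lambda>k. True) (top_of_set (- {b})) (top_of_set (- {b})) (h 1) id"
      using hw[of "- {b}"] nb unfolding id by (auto intro!: homotopic_with_symD)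
  qed
  have sub: "- cball 0 r \<subseteq> - {b}" using b by auto
  show ?thesis
    by (rule very_short_exact_sequence[OF _ triv[of p] triv[of "p-1"]])
       (use homology_exactness_triple_1[OF sub, of p euclidean] homology_exactness_triple_3[OF sub, of p euclidean] in auto)
qed


lemma iso_degree_excision:
  fixes \<phi> :: "'a::euclidean_space \<Rightarrow> 'a"
  assumes "brouwer_degree_defined \<phi> \<Omega> b"
  defines "Z \<equiv> {x\<in>\<Omega>. \<phi> x = b}"
  shows "hom_induced p (top_of_set \<Omega>) (\<Omega> - Z) euclidean (- Z) id
    \<in> iso (relative_homology_group p (top_of_set \<Omega>) (\<Omega> - Z)) (relative_homology_group p euclidean (- Z))"
proof -
  have o: "open \<Omega>" and c: "continuous_on (closure \<Omega>) \<phi>" and nb: "b \<notin> \<phi> ` frontier \<Omega>"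
    using assms by (auto simp: brouwer_degree_defined_def)
  have Z: "Z = {x \<in> closure \<Omega>. \<phi> x = b}"
    unfolding Z_def using nb closure_subset[of \<Omega>] interior_open[OF o]
    by (auto simp: frontier_def image_iff)
  have "closed Z" unfolding Z
    using continuous_closed_preimage_constant[OF c closed_closure] by simp
  then have "euclidean closure_of (- \<Omega>) \<subseteq> euclidean interior_of (- Z)"
    using o by (auto simp: closure_closed closed_Compl interior_open open_Compl Z_def)
  moreover have "- Z - - \<Omega> = \<Omega> - Z" by auto
  ultimately show ?thesis
    using homology_excision_axiom[of euclidean "- \<Omega>" "- Z" UNIV p]
    by (simp add: Compl_eq_Diff_UNIV double_diff)
qed

lemma isomorphic_integer_groupE:
  assumes "group G" "G \<cong> integer_group"
  obtains a where "a \<in> carrier G" "carrier G = range (\<lambda>n::int. a [^]\<^bsub>G\<^esub> n)"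
    "\<And>m n::int. a [^]\<^bsub>G\<^esub> m = a [^]\<^bsub>G\<^esub> n \<Longrightarrow> m = n"
proof -
  interpret group G by fact
  obtain h where h: "h \<in> iso integer_group G"
    using assms iso_sym by (auto simp: is_iso_def)
  interpret h: group_hom integer_group G h
    using h by (auto simp: group_hom_def group_hom_axioms_def iso_def)
  have p: "h n = h 1 [^]\<^bsub>G\<^esub> n" for n :: int
    using h.hom_int_pow[of 1 n] by simp
  have bij: "bij_betw h UNIV (carrier G)" using h by (simp add: iso_def)
  show ?thesis
  proof (rule that[of "h 1"])
    show "h 1 \<in> carrier G" using bij by (auto simp: bij_betw_def)
    show "carrier G = range (\<lambda>n::int. h 1 [^]\<^bsub>G\<^esub> n)"
      using bij by (simp add: bij_betw_def flip: p)
    show "m = n" if "h 1 [^]\<^bsub>G\<^esub> m = h 1 [^]\<^bsub>G\<^esub> n" for m n :: int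
      using bij that by (simp add: bij_betw_def inj_def flip: p)
  qed
qed

lemma brouwer_degree_ex1:
  fixes \<phi> :: "'a::euclidean_space \<Rightarrow> 'a"
  assumes d: "brouwer_degree_defined \<phi> \<Omega> b"
  shows "\<exists>!k. is_brouwer_degree \<phi> \<Omega> b k"
proof -
  define n where "n = int DIM('a)"
  define Z where "Z = {x\<in>\<Omega>. \<phi> x = b}"
  define G where "G = relative_homology_group n (euclidean::'a topology) (- {b})"
  define A where "A = (\<lambda>r. relative_homology_group n (euclidean::'a topology) (- cball 0 r))"
  define Y where "Y = relative_homology_group n (top_of_set \<Omega>) (\<Omega> - Z)"
  define W where "W = relative_homology_group n (euclidean::'a topology) (- Z)"
  define i where "i = (\<lambda>r. hom_induced n (euclidean::'a topology) (- cball 0 r) euclidean (- {b}) id)"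
  define j where "j = (\<lambda>r. hom_induced n (euclidean::'a topology) (- cball 0 r) euclidean (- Z) id)"
  define e where "e = hom_induced n (top_of_set \<Omega>) (\<Omega> - Z) euclidean (- Z) id"
  define F where "F = hom_induced n (top_of_set \<Omega>) (\<Omega> - Z) euclidean (- {b}) \<phi>"
  define s where "s = (\<lambda>r R. hom_induced n (euclidean::'a topology) (- cball 0 R) euclidean (- cball 0 r) id)"
  have iff: "is_brouwer_degree \<phi> \<Omega> b k \<longleftrightarrow>
     (\<forall>r. \<Omega> \<union> {b} \<subseteq> cball 0 r \<longrightarrow> (\<forall>x\<in>carrier (A r). \<forall>y\<in>carrier Y. e y = j r x \<longrightarrow> F y = i r x [^]\<^bsub>G\<^esub> k))" for k
    unfolding is_brouwer_degree_def Let_def n_def[symmetric] Z_def[symmetric]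
      A_def Y_def G_def i_def j_def e_def F_def by (rule refl)
  have grp: "group G" "group (A r)" "group Y" "group W" for r
    by (simp_all add: G_def A_def Y_def W_def)
  have e: "e \<in> iso Y W"
    using iso_degree_excision[OF d] by (simp add: e_def Y_def W_def Z_def)
  have i: "i r \<in> iso (A r) G" if "b \<in> cball 0 r" for r
    using iso_complement_cball_punctured[OF that] by (simp add: i_def A_def G_def)
  have j: "j r \<in> hom (A r) W" for r by (simp add: j_def A_def W_def hom_induced_hom)
  have F: "F \<in> hom Y G" by (simp add: F_def Y_def G_def hom_induced_hom)
  obtain r0 where r0: "\<Omega> \<union> {b} \<subseteq> cball 0 r0"
    using d bounded_subset_ballD[of "\<Omega> \<union> {b}" 0] ball_subset_cball
    by (metis bounded_Un bounded_insert bounded_empty brouwer_degree_defined_def subset_trans)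
  obtain a where a: "a \<in> carrier G" "carrier G = range (\<lambda>n::int. a [^]\<^bsub>G\<^esub> n)"
    "\<And>m n::int. a [^]\<^bsub>G\<^esub> m = a [^]\<^bsub>G\<^esub> n \<Longrightarrow> m = n"
    using isomorphic_integer_groupE[OF grp(1)] homology_punctured_space[of b] by (metis G_def n_def)
  define c where "c = inv_into (carrier Y) e"
  have c: "c \<in> iso W Y" using e grp(3) unfolding c_def by (rule group.iso_set_sym[rotated])
  have ec: "c (e y) = y" if "y \<in> carrier Y" for y
    using e that by (simp add: c_def iso_def bij_betw_def inv_into_f_f)
  have ce: "e (c w) = w" if "w \<in> carrier W" for w
    using e that by (simp add: c_def iso_def bij_betw_def f_inv_into_f)
  have main: "\<exists>!k::int. \<forall>x\<in>carrier (A r). \<forall>y\<in>carrier Y. e y = j r x \<longrightarrow> F y = i r x [^]\<^bsub>G\<^esub> k"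
    if r: "b \<in> cball 0 r" for r
  proof -
    obtain x0 where x0: "x0 \<in> carrier (A r)" "i r x0 = a"
      proof -
      have "i r ` carrier (A r) = carrier G" using i[OF r] by (simp add: iso_def bij_betw_def)
      then show ?thesis using a(1) that by (metis imageE)
    qed
    define y0 where "y0 = c (j r x0)"
    have jx: "j r x \<in> carrier W" if "x \<in> carrier (A r)" for x by (simp add: j_def W_def hom_induced_carrier)
    have y0: "y0 \<in> carrier Y" "e y0 = j r x0"
      using c jx[OF x0(1)] ce[OF jx[OF x0(1)]] by (simp_all add: y0_def iso_def bij_betw_def) blast
    have "F y0 \<in> carrier G" by (simp add: F_def G_def hom_induced_carrier)
    then obtain k :: int where k: "F y0 = a [^]\<^bsub>G\<^esub> k" using a by auto
    interpret h: group_hom "A r" G "F \<circ> c \<circ> j r"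
    proof -
      have "F \<circ> c \<circ> j r \<in> hom (A r) G"
        using j[of r] F c unfolding iso_def by (blast intro: hom_compose)
      then show "group_hom (A r) G (F \<circ> c \<circ> j r)"
        using grp by (simp add: group_hom_def group_hom_axioms_def)
    qed
    interpret ih: group_hom "A r" G "i r"
      using grp i[OF r] by (simp add: group_hom_def group_hom_axioms_def iso_def)
    have cA: "\<exists>m::int. x = x0 [^]\<^bsub>A r\<^esub> m" if "x \<in> carrier (A r)" for x
    proof -
      have "i r x \<in> carrier G" using that by auto
      then obtain m :: int where "i r x = a [^]\<^bsub>G\<^esub> m" using a by auto
      then have "i r x = i r (x0 [^]\<^bsub>A r\<^esub> m)" using ih.hom_int_pow[OF x0(1)] x0(2) by simp
      moreover have "x0 [^]\<^bsub>A r\<^esub> m \<in> carrier (A r)" using x0 by simp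
      moreover have "inj_on (i r) (carrier (A r))" using i[OF r] by (simp add: iso_def bij_betw_def)
      ultimately show ?thesis using that by (metis inj_onD)
    qed
    show ?thesis
    proof (rule ex1I[of _ k], intro ballI impI)
      fix x y assume x: "x \<in> carrier (A r)" and y: "y \<in> carrier Y" and eq: "e y = j r x"
      obtain m :: int where m: "x = x0 [^]\<^bsub>A r\<^esub> m" using cA[OF x] by auto
      have "F y = (F \<circ> c \<circ> j r) x" using ec[OF y] eq by simp
      also have "\<dots> = (F \<circ> c \<circ> j r) x0 [^]\<^bsub>G\<^esub> m" using h.hom_int_pow[OF x0(1)] m by simp
      also have "\<dots> = (a [^]\<^bsub>G\<^esub> k) [^]\<^bsub>G\<^esub> m" using k by (simp add: y0_def)
      also have "\<dots> = (a [^]\<^bsub>G\<^esub> m) [^]\<^bsub>G\<^esub> k" using group.int_pow_pow[OF grp(1) a(1)] by (simp add: mult.commute)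
      also have "\<dots> = i r x [^]\<^bsub>G\<^esub> k" using x0 m by (simp add: ih.hom_int_pow)
      finally show "F y = i r x [^]\<^bsub>G\<^esub> k" .
    next
      fix k' :: int assume "\<forall>x\<in>carrier (A r). \<forall>y\<in>carrier Y. e y = j r x \<longrightarrow> F y = i r x [^]\<^bsub>G\<^esub> k'"
      then have "F y0 = a [^]\<^bsub>G\<^esub> k'" using x0 y0 by auto
      then show "k' = k" using k a(3) by metis
    qed
  qed
  have mono: "(\<forall>x\<in>carrier (A r). \<forall>y\<in>carrier Y. e y = j r x \<longrightarrow> F y = i r x [^]\<^bsub>G\<^esub> k)
       \<Longrightarrow> (\<forall>x\<in>carrier (A R). \<forall>y\<in>carrier Y. e y = j R x \<longrightarrow> F y = i R x [^]\<^bsub>G\<^esub> k)"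
    if r: "\<Omega> \<union> {b} \<subseteq> cball 0 r" "r \<le> R" for r R and k :: int
  proof (intro ballI impI)
    fix x y assume H: "\<forall>x\<in>carrier (A r). \<forall>y\<in>carrier Y. e y = j r x \<longrightarrow> F y = i r x [^]\<^bsub>G\<^esub> k"
      and x: "x \<in> carrier (A R)" and y: "y \<in> carrier Y" and eq: "e y = j R x"
    have "s r R x \<in> carrier (A r)" by (simp add: s_def A_def hom_induced_carrier)
    moreover have "j r (s r R x) = j R x"
      unfolding j_def s_def using r by (subst hom_induced_compose') (auto simp: Z_def)
    moreover have "i r (s r R x) = i R x"
      unfolding i_def s_def using r by (subst hom_induced_compose') auto
    ultimately show "F y = i R x [^]\<^bsub>G\<^esub> k" using H y eq by metis
  qed
  define P where "P = (\<lambda>r (k::int). \<forall>x\<in>carrier (A r). \<forall>y\<in>carrier Y. e y = j r x \<longrightarrow> F y = i r x [^]\<^bsub>G\<^esub> k)"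
  have main': "\<exists>!k. P r k" if "b \<in> cball 0 r" for r
    using main[OF that] unfolding P_def .
  have mono': "P R k" if "\<Omega> \<union> {b} \<subseteq> cball 0 r" "r \<le> R" "P r k" for r R k
    using mono[OF that(1,2) that(3)[unfolded P_def]] unfolding P_def .
  have iff': "is_brouwer_degree \<phi> \<Omega> b k \<longleftrightarrow> (\<forall>r. \<Omega> \<union> {b} \<subseteq> cball 0 r \<longrightarrow> P r k)" for k
    unfolding iff P_def by (rule refl)
  have b0: "b \<in> cball 0 r0" using r0 by simp
  obtain k where k: "P r0 k" using main'[OF b0] by (elim ex1E)
  show ?thesis
  proof (rule ex1I[of _ k])
    show "is_brouwer_degree \<phi> \<Omega> b k" unfolding iff'
    proof (intro allI impI)
      fix r assume r: "\<Omega> \<union> {b} \<subseteq> cball 0 r"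
      then have b: "b \<in> cball 0 r" by simp
      show "P r k"
      proof (cases "r0 \<le> r")
        case True then show ?thesis using mono'[OF r0 True k] by simp
      next
        case False
        obtain k' where k': "P r k'" using main'[OF b] by (elim ex1E)
        have "P r0 k'" using mono'[OF r _ k', of r0] False by simp
        then have "k' = k" using main'[OF b0] k by (metis (full_types))
        then show ?thesis using k' by simp
      qed
    qed
  next
    fix k' assume "is_brouwer_degree \<phi> \<Omega> b k'"
    then have "P r0 k'" using r0 unfolding iff' by (metis (full_types))
    then show "k' = k" using main'[OF b0] k by (metis (full_types))
  qed
qed

lemma brouwer_degree_id:
  fixes \<Omega> :: "'a::euclidean_space set"
  assumes d: "bounded \<Omega>" "open \<Omega>" "b \<in> \<Omega>"
  shows "brouwer_degree_defined id \<Omega> b" "brouwer_degree id \<Omega> b = 1"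
proof -
  show D: "brouwer_degree_defined id \<Omega> b"
    using d by (simp add: brouwer_degree_defined_def frontier_def interior_open)
  have "{x \<in> \<Omega>. id x = b} = {b}" using d by auto
  then have "is_brouwer_degree id \<Omega> b 1"
    unfolding is_brouwer_degree_def Let_def
    apply (intro allI impI ballI)
    apply (simp only:)
    apply (rule group.int_pow_1[symmetric, OF group_relative_homology_group hom_induced_carrier])
    done
  then show "brouwer_degree id \<Omega> b = 1"
    unfolding brouwer_degree_def using brouwer_degree_ex1[OF D] by (simp add: the1_equality)
qed

lemma brouwer_degree_eq_0:
  fixes \<phi> :: "'a::euclidean_space \<Rightarrow> 'a"
  assumes d: "brouwer_degree_defined \<phi> \<Omega> b" and "b \<notin> \<phi> ` \<Omega>"
  shows "brouwer_degree \<phi> \<Omega> b = 0"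
proof -
  have Z: "{x \<in> \<Omega>. \<phi> x = b} = {}" using assms by auto
  define n where "n = int DIM('a)"
  have t: "trivial_group (relative_homology_group n (top_of_set \<Omega>) \<Omega>)"
    using trivial_relative_homology_group_topspace[of n "top_of_set \<Omega>"] by simp
  have "y = \<one>\<^bsub>relative_homology_group n (top_of_set \<Omega>) \<Omega>\<^esub>"
    if "y \<in> carrier (relative_homology_group n (top_of_set \<Omega>) \<Omega>)" for y
    using t that by (auto simp: trivial_group_def)
  then have "hom_induced n (top_of_set \<Omega>) \<Omega> euclidean (- {b}) \<phi> y =
        \<one>\<^bsub>relative_homology_group n euclidean (- {b})\<^esub>"
    if "y \<in> carrier (relative_homology_group n (top_of_set \<Omega>) \<Omega>)" for y
    using that hom_one[OF hom_induced_hom group_relative_homology_group group_relative_homology_group] by metis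
  then have "is_brouwer_degree \<phi> \<Omega> b 0"
    unfolding is_brouwer_degree_def Let_def Z n_def[symmetric] by simp
  then show ?thesis
    unfolding brouwer_degree_def using brouwer_degree_ex1[OF d] by (simp add: the1_equality)
qed

end

(* Write R for the recession cone of K. A solution of the variational inequality is a zero of the
   natural map g - proj_K (g - f). With K replaced by the homothets t K, which shrink to R as t
   tends to 0, one obtains a homotopy of natural maps that joins the one of the cone problem with
   the shift d at t = 0 to the one of the given problem at t = 1. Rescaling a sequence of zeros
   that escapes to infinity produces a nonzero solution of the leading-term problem on R, so the
   zeros stay bounded. On Omega the vector d + f - g does not leave the dual cone of R, so there
   the projection vanishes and the natural map at t = 0 coincides with g (or its leading term),
   whose degree is nonzero. The problem on R itself is the case K := R. *)
theory Submission
  imports Defs "HOL-Real_Asymp.Real_Asymp"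
begin

section \<open>Recession cones\<close>

text \<open>If \<open>x k / t k\<close> tends to \<open>u\<close>, then the convex combinations of
  \<open>y\<close> and \<open>x k\<close> with weight \<open>s / t k\<close> on \<open>x k\<close>
  stay in \<open>K\<close> and tend to \<open>y + s u\<close>; closedness finishes. Conversely, the
  points \<open>w + k u\<close> on one ray of \<open>K\<close> realise \<open>u\<close> as a limit.
  The form without sequences makes closedness and the cone property immediate.\<close>

lemma recession_cone_eq:
  fixes K :: "'a::real_normed_vector set"
  assumes "K \<noteq> {}" "closed K" "convex K"
  shows "recession_cone K = {u. \<forall>x\<in>K. \<forall>s\<ge>0. x + s *\<^sub>R u \<in> K}"
proof (intro subset_antisym subsetI)
  fix u assume "u \<in> recession_cone K"
  then obtain t :: "nat \<Rightarrow> real" and x where t: "filterlim t at_top sequentially"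
    and x: "\<And>k. x k \<in> K" and lim: "(\<lambda>k. x k /\<^sub>R t k) \<longlonglongrightarrow> u"
    by (auto simp: recession_cone_def)
  have "y + s *\<^sub>R u \<in> K" if y: "y \<in> K" and s: "s \<ge> 0" for y s
  proof (rule Lim_in_closed_set[OF \<open>closed K\<close>])
    have inv: "(\<lambda>k. s / t k) \<longlonglongrightarrow> 0"
      by (rule real_tendsto_divide_at_top[OF tendsto_const t])
    have "(\<lambda>k. (1 - s / t k) *\<^sub>R y + s *\<^sub>R (x k /\<^sub>R t k)) \<longlonglongrightarrow> (1 - 0) *\<^sub>R y + s *\<^sub>R u"
      by (intro tendsto_intros inv lim)
    then show "(\<lambda>k. (1 - s / t k) *\<^sub>R y + (s / t k) *\<^sub>R x k) \<longlonglongrightarrow> y + s *\<^sub>R u"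
      by (simp add: divide_inverse)
    \<comment> \<open>The bound \<open>s + 1\<close> gives both \<open>t k > 0\<close> and a weight
      \<open>s / t k\<close> of at most 1.\<close>
    have "\<forall>\<^sub>F k in sequentially. t k \<ge> s + 1"
      using t by (simp add: filterlim_at_top)
    then show "\<forall>\<^sub>F k in sequentially. (1 - s / t k) *\<^sub>R y + (s / t k) *\<^sub>R x k \<in> K"
    proof eventually_elim
      case (elim k)
      then have "0 \<le> s / t k" "s / t k \<le> 1" using s by auto
      then show ?case using convexD[OF \<open>convex K\<close> y x[of k], of "1 - s / t k" "s / t k"] by simp
    qed
  qed simp
  then show "u \<in> {u. \<forall>x\<in>K. \<forall>s\<ge>0. x + s *\<^sub>R u \<in> K}" by auto
next
  fix u assume u: "u \<in> {u. \<forall>x\<in>K. \<forall>s\<ge>0. x + s *\<^sub>R u \<in> K}"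
  obtain w where w: "w \<in> K" using \<open>K \<noteq> {}\<close> by auto
  have "(\<lambda>k. inverse (real k) *\<^sub>R w + u) \<longlonglongrightarrow> 0 *\<^sub>R w + u"
    by (intro tendsto_intros lim_inverse_n)
  moreover have "\<forall>\<^sub>F k in sequentially. inverse (real k) *\<^sub>R w + u = (w + real k *\<^sub>R u) /\<^sub>R real k"
    using eventually_gt_at_top[of 0] by eventually_elim (simp add: scaleR_add_right)
  ultimately have "(\<lambda>k. (w + real k *\<^sub>R u) /\<^sub>R real k) \<longlonglongrightarrow> u"
    by (simp add: filterlim_cong[OF refl refl])
  moreover have "\<forall>k. w + real k *\<^sub>R u \<in> K" using u w by simp
  ultimately show "u \<in> recession_cone K"
    unfolding recession_cone_def mem_Collect_eq
    by (intro exI[of _ real] exI[of _ "\<lambda>k. w + real k *\<^sub>R u"] conjI filterlim_real_sequentially)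
qed

lemma closed_recession_cone:
  fixes K :: "'a::real_normed_vector set"
  assumes "K \<noteq> {}" "closed K" "convex K"
  shows "closed (recession_cone K)"
proof -
  have "recession_cone K = (\<Inter>x\<in>K. \<Inter>s\<in>{0..}. (\<lambda>u. x + s *\<^sub>R u) -` K)"
    unfolding recession_cone_eq[OF assms] by auto
  moreover have "closed ((\<lambda>u. x + s *\<^sub>R u) -` K)" for x s
    using \<open>closed K\<close> by (rule closed_vimage) (intro continuous_intros)
  ultimately show ?thesis by (simp add: closed_INT)
qed

lemma convex_cone_recession_cone:
  fixes K :: "'a::real_normed_vector set"
  assumes "K \<noteq> {}" "closed K" "convex K"
  shows "convex_cone (recession_cone K)"
  unfolding convex_cone_iff recession_cone_eq[OF assms]
proof (safe, goal_cases)
  case (1 x s) then show ?case by simp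
next
  case (2 u v x s)
  then have "(x + s *\<^sub>R u) + s *\<^sub>R v \<in> K" by blast
  then show ?case by (simp add: algebra_simps)
next
  case (3 u c x s)
  then have "x + (s * c) *\<^sub>R u \<in> K" by simp
  then show ?case by simp
qed

lemma recession_cone_subset:
  fixes C :: "'a::real_normed_vector set"
  assumes K: "K \<noteq> {}" "closed K" "convex K" and C: "closed C" "convex_cone C" "K \<subseteq> C"
  shows "recession_cone K \<subseteq> C"
proof
  fix u assume "u \<in> recession_cone K"
  then obtain t :: "nat \<Rightarrow> real" and x where t: "filterlim t at_top sequentially"
    and x: "\<And>k. x k \<in> K" and lim: "(\<lambda>k. x k /\<^sub>R t k) \<longlonglongrightarrow> u"
    by (auto simp: recession_cone_def)
  have "\<forall>\<^sub>F k in sequentially. t k \<ge> 0" using t by (simp add: filterlim_at_top)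
  then have "\<forall>\<^sub>F k in sequentially. x k /\<^sub>R t k \<in> C"
    by eventually_elim (metis C(2,3) convex_cone_scaleR inverse_nonnegative_iff_nonnegative subsetD x)
  then show "u \<in> C" by (rule Lim_in_closed_set[OF \<open>closed C\<close> _ _ lim]) simp
qed

lemma recession_cone_convex_cone:
  fixes C :: "'a::real_normed_vector set"
  assumes "closed C" "convex_cone C"
  shows "recession_cone C = C"
proof
  have C: "C \<noteq> {}" "convex C" using assms by (auto simp: convex_cone_def)
  show "recession_cone C \<subseteq> C" using recession_cone_subset[OF C(1) assms(1) C(2) assms] by simp
  show "C \<subseteq> recession_cone C"
    unfolding recession_cone_eq[OF C(1) assms(1) C(2)]
    using assms(2) by (auto intro: convex_cone_add convex_cone_scaleR)
qed

section \<open>The homothets \<open>t K\<close> and their limit\<close>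

text \<open>For \<open>t > 0\<close> this is \<open>t K\<close>, and for \<open>t = 0\<close> the recession cone; the uniform description
  makes the closedness of the graph \<open>{(t, z). z \<in> homothet K t}\<close> evident.\<close>

definition homothet :: "'a::real_vector set \<Rightarrow> real \<Rightarrow> 'a set"
  where "homothet K t = {z. \<forall>x\<in>K. \<forall>s\<ge>0. s * t \<le> 1 \<longrightarrow> x + s *\<^sub>R (z - t *\<^sub>R x) \<in> K}"

lemma homothet_0:
  fixes K :: "'a::real_normed_vector set"
  assumes "K \<noteq> {}" "closed K" "convex K"
  shows "homothet K 0 = recession_cone K"
  by (simp add: homothet_def recession_cone_eq[OF assms])

text \<open>The extreme admissible step \<open>s = 1 / t\<close> moves any \<open>x\<close> to
  \<open>z / t\<close>, which puts \<open>z / t\<close> into \<open>K\<close>. Conversely, for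
  \<open>z = t w\<close> every admissible step is a convex combination of \<open>x\<close> and
  \<open>w\<close>.\<close>

lemma homothet_pos:
  assumes "K \<noteq> {}" "convex K" "t > 0"
  shows "homothet K t = (*\<^sub>R) t ` K"
proof (intro subset_antisym subsetI)
  fix z assume z: "z \<in> homothet K t"
  obtain w where w: "w \<in> K" using \<open>K \<noteq> {}\<close> by auto
  have "w + inverse t *\<^sub>R (z - t *\<^sub>R w) \<in> K"
    using z w \<open>t > 0\<close> by (auto simp: homothet_def)
  moreover have "w + inverse t *\<^sub>R (z - t *\<^sub>R w) = z /\<^sub>R t"
    using \<open>t > 0\<close> by (simp add: algebra_simps)
  ultimately show "z \<in> (*\<^sub>R) t ` K"
    using \<open>t > 0\<close> by (auto intro!: image_eqI[of _ _ "z /\<^sub>R t"])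
next
  fix z assume "z \<in> (*\<^sub>R) t ` K"
  then obtain w where w: "w \<in> K" "z = t *\<^sub>R w" by auto
  have "x + s *\<^sub>R (z - t *\<^sub>R x) \<in> K" if "x \<in> K" "s \<ge> 0" "s * t \<le> 1" for x s
  proof -
    have "(1 - s * t) *\<^sub>R x + (s * t) *\<^sub>R w \<in> K"
      using that \<open>t > 0\<close> w by (intro convexD[OF \<open>convex K\<close>]) auto
    then show ?thesis using w by (simp add: algebra_simps)
  qed
  then show "z \<in> homothet K t" by (auto simp: homothet_def)
qed

lemma homothet_1:
  assumes "K \<noteq> {}" "convex K"
  shows "homothet K 1 = K"
  by (simp add: homothet_pos assms)

lemma convex_homothet:
  assumes "convex K"
  shows "convex (homothet K t)"
proof (rule convexI)
  fix y z and u v :: real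
  assume yz: "y \<in> homothet K t" "z \<in> homothet K t" and uv: "0 \<le> u" "0 \<le> v" "u + v = 1"
  show "u *\<^sub>R y + v *\<^sub>R z \<in> homothet K t"
    unfolding homothet_def
  proof (safe, goal_cases)
    case (1 x s)
    have "u *\<^sub>R (x + s *\<^sub>R (y - t *\<^sub>R x)) + v *\<^sub>R (x + s *\<^sub>R (z - t *\<^sub>R x)) \<in> K"
      using yz uv 1 by (intro convexD[OF \<open>convex K\<close>]) (auto simp: homothet_def)
    also have "u *\<^sub>R (x + s *\<^sub>R (y - t *\<^sub>R x)) + v *\<^sub>R (x + s *\<^sub>R (z - t *\<^sub>R x)) =
        (u + v) *\<^sub>R x + s *\<^sub>R (u *\<^sub>R y + v *\<^sub>R z - (u + v) *\<^sub>R (t *\<^sub>R x))"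
      by (simp add: algebra_simps)
    finally show ?case using uv by simp
  qed
qed

lemma homothet_closed_graph:
  fixes K :: "'a::real_normed_vector set"
  assumes K: "closed K" and z: "\<And>n. z n \<in> homothet K (t n)"
    and lim: "t \<longlonglongrightarrow> t'" "z \<longlonglongrightarrow> z'"
  shows "z' \<in> homothet K t'"
  unfolding homothet_def
proof (safe, goal_cases)
  case (1 x s)
  show ?case
  proof (rule Lim_in_closed_set[OF K])
    \<comment> \<open>The step \<open>s\<close> may violate \<open>s * t n <= 1\<close> although the
      limit satisfies \<open>s * t' <= 1\<close>. The truncated steps are admissible for every
      \<open>n\<close> and still tend to \<open>s\<close>.\<close>
    let ?s = "\<lambda>n. s / max 1 (s * t n)"
    have "?s \<longlonglongrightarrow> s / max 1 (s * t')" by (intro tendsto_intros lim) auto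
    then have "?s \<longlonglongrightarrow> s" using 1 by simp
    then show "(\<lambda>n. x + ?s n *\<^sub>R (z n - t n *\<^sub>R x)) \<longlonglongrightarrow> x + s *\<^sub>R (z' - t' *\<^sub>R x)"
      by (intro tendsto_intros lim)
    have "?s n \<ge> 0 \<and> ?s n * t n \<le> 1" for n
      using 1 by (auto simp: max_def divide_simps)
    then show "\<forall>\<^sub>F n in sequentially. x + ?s n *\<^sub>R (z n - t n *\<^sub>R x) \<in> K"
      using z 1 by (auto simp: homothet_def)
  qed simp
qed

lemma closed_homothet:
  fixes K :: "'a::real_normed_vector set"
  assumes "closed K"
  shows "closed (homothet K t)"
  unfolding closed_sequential_limits
  using homothet_closed_graph[OF assms, of _ "\<lambda>_. t"] by auto

text \<open>A step towards \<open>t w\<close> is a convex combination of \<open>x\<close> and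
  \<open>w\<close>, and the remaining displacement \<open>s u\<close> is a recession direction.
  Because \<open>t = 0\<close> is included, this supplies approximating points near the limit cone
  and test vectors for the variational inequalities.\<close>

lemma homothet_add_recession:
  fixes K :: "'a::real_normed_vector set"
  assumes K: "K \<noteq> {}" "closed K" "convex K" and "0 \<le> t" "w \<in> K" "u \<in> recession_cone K"
  shows "t *\<^sub>R w + u \<in> homothet K t"
  unfolding homothet_def
proof (safe, goal_cases)
  case (1 x s)
  have "(1 - s * t) *\<^sub>R x + (s * t) *\<^sub>R w \<in> K"
    using 1 assms by (intro convexD[OF \<open>convex K\<close>]) auto
  then have "((1 - s * t) *\<^sub>R x + (s * t) *\<^sub>R w) + s *\<^sub>R u \<in> K"
    using assms(6) 1 unfolding recession_cone_eq[OF K] by blast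
  then show ?case by (simp add: algebra_simps)
qed

lemma homothet_nonempty:
  fixes K :: "'a::real_normed_vector set"
  assumes "K \<noteq> {}" "closed K" "convex K" "0 \<le> t"
  shows "homothet K t \<noteq> {}"
  using homothet_add_recession[OF assms] assms(1)
    convex_cone_contains_0[OF convex_cone_recession_cone[OF assms(1-3)]] by blast

lemma homothet_subset:
  fixes K :: "'a::real_normed_vector set"
  assumes K: "K \<noteq> {}" "closed K" "convex K" and C: "closed C" "convex_cone C" "K \<subseteq> C" and "0 \<le> t"
  shows "homothet K t \<subseteq> C"
proof (cases "t = 0")
  case True
  then show ?thesis using recession_cone_subset[OF K C] homothet_0[OF K] by simp
next
  case False
  then show ?thesis
    using assms homothet_pos[of K t] by (auto intro!: convex_cone_scaleR)
qed

section \<open>Metric projections\<close>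

text \<open>The variational inequality characterises the projection: expanding the square of
  \<open>a - y = (a - p) - (y - p)\<close> shows that \<open>p\<close> is at least as close to
  \<open>a\<close> as any \<open>y\<close>.\<close>

lemma closest_point_eq_iff:
  fixes S :: "'a::euclidean_space set"
  assumes "S \<noteq> {}" "closed S" "convex S"
  shows "closest_point S a = p \<longleftrightarrow> p \<in> S \<and> (\<forall>y\<in>S. (a - p) \<bullet> (y - p) \<le> 0)"
proof safe
  show "closest_point S a \<in> S" using assms by (simp add: closest_point_in_set)
  show "(a - closest_point S a) \<bullet> (y - closest_point S a) \<le> 0" if "y \<in> S" for y
    using closest_point_dot[OF assms(3,2) that] .
next
  assume p: "p \<in> S" "\<forall>y\<in>S. (a - p) \<bullet> (y - p) \<le> 0"
  have "dist a p \<le> dist a y" if "y \<in> S" for y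
  proof -
    have "(a - y) \<bullet> (a - y) = (a - p) \<bullet> (a - p) + (y - p) \<bullet> (y - p) - 2 * ((a - p) \<bullet> (y - p))"
      by (simp add: algebra_simps inner_commute)
    then have "(norm (a - p))\<^sup>2 \<le> (norm (a - y))\<^sup>2"
      using p that by (simp add: power2_norm_eq_inner) (smt (verit) inner_ge_zero)
    then show ?thesis by (simp add: dist_norm power2_le_iff_abs_le)
  qed
  then show "closest_point S a = p" using closest_point_unique[OF assms(3,2) p(1)] by simp
qed

text \<open>On bounded sets the projections take values in a compact ball, so a closed graph
  suffices. Closedness passes the variational inequality to the limit: limits of points of the
  homothets lie in the limit homothet, and every test point of the limit homothet is itself
  approximated from the homothets.\<close>

lemma continuous_on_closest_point_homothet:
  fixes K :: "'a::euclidean_space set"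
  assumes K: "K \<noteq> {}" "closed K" "convex K"
  shows "continuous_on ({0..1} \<times> UNIV) (\<lambda>(t, z). closest_point (homothet K t) z)"
proof -
  let ?P = "\<lambda>(t, z). closest_point (homothet K t) z"
  obtain w where w: "w \<in> K" using K by auto
  have tw: "t *\<^sub>R w \<in> homothet K t" if "0 \<le> t" for t
    using homothet_add_recession[OF K that w, of 0]
      convex_cone_contains_0[OF convex_cone_recession_cone[OF K]] by simp
  note homothet = closed_homothet[OF K(2)] convex_homothet[OF K(3)]
  have P: "closest_point (homothet K t) z = p \<longleftrightarrow>
      p \<in> homothet K t \<and> (\<forall>y\<in>homothet K t. (z - p) \<bullet> (y - p) \<le> 0)" if "0 \<le> t" for t z p
    using closest_point_eq_iff[OF homothet_nonempty[OF K that] homothet] .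
  \<comment> \<open>The approximation of test points. At \<open>t' = 0\<close> the point
    \<open>y\<close> is a recession direction and is shifted by \<open>t n w\<close>; otherwise
    \<open>y = t' v\<close> and the points \<open>t n v\<close> serve.\<close>
  have approx: "\<exists>v. (\<forall>n. v n \<in> homothet K (t n)) \<and> v \<longlonglongrightarrow> y"
    if t: "\<And>n. 0 \<le> t n" "t \<longlonglongrightarrow> t'" and y: "y \<in> homothet K t'" for t :: "nat \<Rightarrow> real" and t' y
  proof (cases "t' = 0")
    case True
    then have "t n *\<^sub>R w + y \<in> homothet K (t n)" for n
      using homothet_add_recession[OF K t(1) w] y homothet_0[OF K] by simp
    moreover have "(\<lambda>n. t n *\<^sub>R w + y) \<longlonglongrightarrow> t' *\<^sub>R w + y" by (intro tendsto_intros t)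
    ultimately show ?thesis using True by (intro exI[of _ "\<lambda>n. t n *\<^sub>R w + y"]) simp
  next
    case False
    moreover have "t' \<ge> 0" using LIMSEQ_le_const[OF t(2)] t(1) by blast
    ultimately obtain v where v: "v \<in> K" "y = t' *\<^sub>R v"
      using homothet_pos[OF K(1,3), of t'] y by auto
    then have "t n *\<^sub>R v \<in> homothet K (t n)" for n
      using homothet_add_recession[OF K t(1) v(1), of 0]
        convex_cone_contains_0[OF convex_cone_recession_cone[OF K]] by simp
    moreover have "(\<lambda>n. t n *\<^sub>R v) \<longlonglongrightarrow> y" unfolding v by (intro tendsto_intros t)
    ultimately show ?thesis by (intro exI[of _ "\<lambda>n. t n *\<^sub>R v"]) simp
  qed
  have cont: "continuous_on ({0..1} \<times> cball 0 r) ?P" for r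
  proof (rule continuous_from_closed_graph)
    show "compact (cball (0::'a) (2 * norm w + r))" by simp
    show "?P \<in> {0..1} \<times> cball 0 r \<rightarrow> cball 0 (2 * norm w + r)"
    proof safe
      fix t :: real and z :: 'a assume t: "t \<in> {0..1}" and z: "z \<in> cball 0 r"
      have tn: "norm (t *\<^sub>R w) \<le> norm w" using t by (simp add: mult_left_le_one_le)
      \<comment> \<open>The projection is nonexpansive and fixes \<open>t w\<close>, which bounds it
        uniformly in \<open>t\<close>.\<close>
      have "closest_point (homothet K t) (t *\<^sub>R w) = t *\<^sub>R w"
        using tw t by (simp add: closest_point_self)
      moreover have "homothet K t \<noteq> {}" using homothet_nonempty[OF K] t by simp
      ultimately have "dist (closest_point (homothet K t) z) (t *\<^sub>R w) \<le> dist z (t *\<^sub>R w)"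
        using closest_point_lipschitz[OF homothet(2,1), of t z "t *\<^sub>R w"] by simp
      then have "norm (closest_point (homothet K t) z) \<le> norm z + 2 * norm (t *\<^sub>R w)"
        unfolding dist_norm using norm_triangle_ineq4[of z "t *\<^sub>R w"]
          norm_triangle_ineq2[of "closest_point (homothet K t) z" "t *\<^sub>R w"] by linarith
      then show "closest_point (homothet K t) z \<in> cball 0 (2 * norm w + r)"
        using tn z by simp
    qed
    show "closed ((\<lambda>x. (x, ?P x)) ` ({0..1} \<times> cball 0 r))"
      unfolding closed_sequential_limits
    proof safe
      fix a :: "nat \<Rightarrow> (real \<times> 'a) \<times> 'a" and t z p
      assume a: "\<forall>n. a n \<in> (\<lambda>x. (x, ?P x)) ` ({0..1} \<times> cball 0 r)" and lim: "a \<longlonglongrightarrow> ((t, z), p)"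
      define ta za pa where "ta n = fst (fst (a n))" and "za n = snd (fst (a n))" and "pa n = snd (a n)" for n
      have lims: "ta \<longlonglongrightarrow> t" "za \<longlonglongrightarrow> z" "pa \<longlonglongrightarrow> p"
        using tendsto_fst[OF lim] tendsto_snd[OF lim] tendsto_fst[OF tendsto_fst[OF lim]]
          tendsto_snd[OF tendsto_fst[OF lim]] by (simp_all add: ta_def[abs_def] za_def[abs_def] pa_def[abs_def])
      have an: "ta n \<in> {0..1} \<and> za n \<in> cball 0 r \<and> closest_point (homothet K (ta n)) (za n) = pa n" for n
        using a[rule_format, of n] by (auto simp: ta_def za_def pa_def)
      have t: "t \<in> {0..1}" using an lims(1) by (meson closed_atLeastAtMost closed_sequentially)
      have z: "z \<in> cball 0 r" using an lims(2) by (meson closed_cball closed_sequentially)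
      have pan: "pa n \<in> homothet K (ta n)" "\<And>y. y \<in> homothet K (ta n) \<Longrightarrow> (za n - pa n) \<bullet> (y - pa n) \<le> 0" for n
        using an[of n] P[of "ta n" "za n" "pa n"] by auto
      have "closest_point (homothet K t) z = p"
      proof (subst P, use t in simp, safe)
        show "p \<in> homothet K t" using homothet_closed_graph[OF K(2) pan(1) lims(1,3)] .
        fix y assume "y \<in> homothet K t"
        then obtain v where v: "\<And>n. v n \<in> homothet K (ta n)" "v \<longlonglongrightarrow> y"
          using approx[OF _ lims(1)] an by (metis atLeastAtMost_iff)
        have "(\<lambda>n. (za n - pa n) \<bullet> (v n - pa n)) \<longlonglongrightarrow> (z - p) \<bullet> (y - p)"
          by (intro tendsto_intros lims v)
        then show "(z - p) \<bullet> (y - p) \<le> 0"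
          using pan(2) v(1) by (intro LIMSEQ_le_const2) auto
      qed
      then show "((t, z), p) \<in> (\<lambda>x. (x, ?P x)) ` ({0..1} \<times> cball 0 r)"
        using t z by auto
    qed
  qed
  show ?thesis
    unfolding continuous_on_eq_continuous_within
  proof
    fix x :: "real \<times> 'a" assume x: "x \<in> {0..1} \<times> UNIV"
    \<comment> \<open>Continuity is local, so a bounded open neighbourhood of the point reduces the
      claim to \<open>cont\<close>.\<close>
    let ?U = "UNIV \<times> ball 0 (norm (snd x) + 1)"
    have "continuous_on (({0..1} \<times> UNIV) \<inter> ?U) ?P"
      by (rule continuous_on_subset[OF cont[of "norm (snd x) + 1"]]) auto
    moreover have "open ?U" "x \<in> ?U" by (auto intro: open_Times simp: mem_Times_iff)
    moreover from this have "at x within ({0..1} \<times> UNIV) \<inter> ?U = at x within {0..1} \<times> UNIV"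
      by (intro at_within_nhd[of x ?U]) auto
    ultimately show "continuous (at x within {0..1} \<times> UNIV) ?P"
      using x by (metis IntI continuous_on_eq_continuous_within)
  qed
qed

section \<open>Zeros of homotopies of nonzero degree\<close>

text \<open>Inclusion carries both groups isomorphically onto the homology relative to the
  complement of the origin, and the inclusions commute. Hence a class used to test the degree can be
  represented relative to the complement of an arbitrarily large ball.\<close>

lemma surj_complement_cball:
  fixes r R :: real
  assumes "0 \<le> r" "r \<le> R"
    and x: "x \<in> carrier (relative_homology_group p (euclidean::'a::euclidean_space topology) (- cball 0 r))"
  obtains y where "y \<in> carrier (relative_homology_group p (euclidean::'a topology) (- cball 0 R))"
    "hom_induced p (euclidean::'a topology) (- cball 0 R) euclidean (- cball 0 r) id y = x"
proof -
  define A where "A = (\<lambda>r. relative_homology_group p (euclidean::'a topology) (- cball 0 r))"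
  define G where "G = relative_homology_group p (euclidean::'a topology) (- {0})"
  define i where "i = (\<lambda>r. hom_induced p (euclidean::'a topology) (- cball 0 r) euclidean (- {0}) id)"
  define s where "s = hom_induced p (euclidean::'a topology) (- cball 0 R) euclidean (- cball 0 r) id"
  have i: "i r \<in> iso (A r) G" "i R \<in> iso (A R) G"
    unfolding i_def A_def G_def using assms by (auto intro!: iso_complement_cball_punctured)
  have xA: "x \<in> carrier (A r)" using x by (simp add: A_def)
  obtain y where y: "y \<in> carrier (A R)" "i R y = i r x"
  proof -
    have "i R ` carrier (A R) = carrier G" "i r x \<in> carrier G"
      using i xA by (auto simp: iso_def bij_betw_def)
    then show ?thesis using that by (metis imageE)
  qed
  have "i r (s y) = i R y"
    unfolding i_def s_def using assms by (subst hom_induced_compose') auto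
  moreover have "s y \<in> carrier (A r)" by (simp add: s_def A_def hom_induced_carrier)
  ultimately have "s y = x"
    using i(1) xA y(2) by (auto simp: iso_def bij_betw_def dest: inj_onD)
  then show ?thesis using that y by (simp add: A_def s_def)
qed

text \<open>If \<open>\<Phi> 1\<close> had no zero, it would send the test class into the homology
  of the punctured space relative to itself, which is trivial. The homotopy outside a large ball
  transfers this to \<open>\<Phi> 0\<close>, so 0 would satisfy the characterisation of the degree
  of \<open>\<phi>\<close>, against its uniqueness. Working on the whole space, only a common bound
  on the zeros is required, not a domain that is fixed along the homotopy.\<close>

lemma exists_zero_of_homotopy_degree:
  fixes \<Phi> :: "real \<Rightarrow> 'a::euclidean_space \<Rightarrow> 'a" and \<phi> :: "'a \<Rightarrow> 'a"
  assumes cont: "continuous_on ({0..1} \<times> UNIV) (\<lambda>(t, x). \<Phi> t x)"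
    and bdd: "\<And>t x. t \<in> {0..1} \<Longrightarrow> \<Phi> t x = 0 \<Longrightarrow> norm x \<le> M"
    and deg: "brouwer_degree_defined \<phi> \<Omega> 0" "brouwer_degree \<phi> \<Omega> 0 \<noteq> 0"
    and eq: "\<And>x. x \<in> \<Omega> \<Longrightarrow> \<Phi> 0 x = \<phi> x"
    and zeros: "\<And>x. \<Phi> 0 x = 0 \<Longrightarrow> x \<in> \<Omega>"
  shows "\<exists>x. \<Phi> 1 x = 0"
proof (rule ccontr)
  assume "\<not> (\<exists>x. \<Phi> 1 x = 0)"
  then have no_zero: "\<Phi> 1 x \<noteq> 0" for x by auto
  define n where "n = int DIM('a)"
  define Z where "Z = {x\<in>\<Omega>. \<phi> x = 0}"
  define G where "G = relative_homology_group n (euclidean::'a topology) (- {0})"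
  have cont_slice: "continuous_on UNIV (\<Phi> t)" if "t \<in> {0..1}" for t
  proof -
    have "continuous_on UNIV ((\<lambda>(t, x). \<Phi> t x) \<circ> (\<lambda>x. (t, x)))"
      using that by (intro continuous_on_compose continuous_intros continuous_on_subset[OF cont]) auto
    then show ?thesis by (simp add: o_def)
  qed
  \<comment> \<open>By \<open>zeros\<close>, the set \<open>Z\<close> contains all zeros of
    \<open>\<Phi> 0\<close> in the space, so \<open>\<Phi> 0\<close> is a map of pairs on the
    complement of \<open>Z\<close>.\<close>
  have Z: "\<Phi> 0 x = 0 \<longleftrightarrow> x \<in> Z" for x using eq[of x] zeros[of x] by (auto simp: Z_def)
  have "is_brouwer_degree \<phi> \<Omega> 0 0"
    unfolding is_brouwer_degree_def Let_def n_def[symmetric] Z_def[symmetric] G_def[symmetric]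
  proof (intro allI impI ballI)
    fix r x y
    assume r: "\<Omega> \<union> {0} \<subseteq> cball 0 r"
      and x: "x \<in> carrier (relative_homology_group n (euclidean::'a topology) (- cball 0 r))"
      and y: "y \<in> carrier (relative_homology_group n (top_of_set \<Omega>) (\<Omega> - Z))"
      and xy: "hom_induced n (top_of_set \<Omega>) (\<Omega> - Z) euclidean (- Z) id y =
          hom_induced n euclidean (- cball 0 r) euclidean (- Z) id x"
    \<comment> \<open>Outside this ball no \<open>\<Phi> t\<close> vanishes, so the homotopy is one
      of maps of pairs; \<open>R >= r\<close> is what allows the class \<open>x\<close> to be
      lifted.\<close>
    define R where "R = max r M"
    have "0 \<le> r" using r by simp
    then obtain x' where x': "x' \<in> carrier (relative_homology_group n (euclidean::'a topology) (- cball 0 R))"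
      "hom_induced n (euclidean::'a topology) (- cball 0 R) euclidean (- cball 0 r) id x' = x"
      using surj_complement_cball[OF _ _ x, of R] by (auto simp: R_def)
    have Z_sub: "Z \<subseteq> cball 0 r" using r by (auto simp: Z_def)
    have outside: "\<Phi> t z \<noteq> 0" if "t \<in> {0..1}" "z \<notin> cball 0 R" for t z
      using bdd[OF that(1)] that(2) by (force simp: R_def)
    \<comment> \<open>The class is followed by naturality from \<open>\<Omega>\<close> through the
      pair of the space and the complement of \<open>Z\<close> to the large ball, always with the
      same map \<open>\<Phi> 0\<close>.\<close>
    have "hom_induced n (top_of_set \<Omega>) (\<Omega> - Z) euclidean (- {0}) \<phi> y =
        hom_induced n (top_of_set \<Omega>) (\<Omega> - Z) euclidean (- {0}) (\<Phi> 0 \<circ> id) y"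
      by (rule arg_cong[where f = "\<lambda>h. h y"], rule hom_induced_eq) (simp add: eq)
    also have "\<dots> = hom_induced n euclidean (- Z) euclidean (- {0}) (\<Phi> 0)
        (hom_induced n (top_of_set \<Omega>) (\<Omega> - Z) euclidean (- Z) id y)"
      using cont_slice[of 0] by (subst hom_induced_compose') (auto simp: Z)
    also have "\<dots> = hom_induced n euclidean (- cball 0 r) euclidean (- {0}) (\<Phi> 0) x"
      unfolding xy using cont_slice[of 0] Z_sub by (subst hom_induced_compose') (auto simp: Z)
    also have "\<dots> = hom_induced n euclidean (- cball 0 R) euclidean (- {0}) (\<Phi> 0) x'"
      unfolding x'(2)[symmetric] using cont_slice[of 0] Z_sub
      by (subst hom_induced_compose') (auto simp: Z R_def)
    also have "\<dots> = hom_induced n euclidean (- cball 0 R) euclidean (- {0}) (\<Phi> 1) x'"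
    proof (rule arg_cong[where f = "\<lambda>h. h x'"], rule homology_homotopy_axiom)
      show "homotopic_with (\<lambda>h. h \<in> - cball 0 R \<rightarrow> - {0}) euclidean euclidean (\<Phi> 0) (\<Phi> 1)"
        unfolding homotopic_with_def
      proof (intro exI[of _ "\<lambda>(t, x). \<Phi> t x"] conjI)
        have "prod_topology (top_of_set {0..1::real}) euclidean = top_of_set ({0..1} \<times> (UNIV::'a set))"
          using prod_topology_subtopology_eu[of "{0..1::real}" "UNIV::'a set"] by simp
        then show "continuous_map (prod_topology (top_of_set {0..1}) euclidean) euclidean (\<lambda>(t, x). \<Phi> t x)"
          using cont by simp
      qed (use outside in auto)
    qed
    \<comment> \<open>Without zeros, \<open>\<Phi> 1\<close> factors through a pair whose two
      members coincide.\<close>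
    also have "\<dots> = hom_induced n (top_of_set (- {0})) (- {0}) euclidean (- {0}) id
        (hom_induced n euclidean (- cball 0 R) (top_of_set (- {0})) (- {0}) (\<Phi> 1) x')"
      using cont_slice[of 1] no_zero
      by (subst hom_induced_compose') (auto simp: continuous_map_in_subtopology)
    also have "hom_induced n euclidean (- cball 0 R) (top_of_set (- {0})) (- {0}) (\<Phi> 1) x' =
        \<one>\<^bsub>relative_homology_group n (top_of_set (- {0::'a})) (- {0})\<^esub>"
      using trivial_relative_homology_group_topspace[of n "top_of_set (- {0::'a})"]
        hom_induced_carrier[of n euclidean "- cball 0 R" "top_of_set (- {0::'a})" "- {0}" "\<Phi> 1" x']
      by (auto simp: trivial_group_def)
    also have "hom_induced n (top_of_set (- {0})) (- {0}) euclidean (- {0}) id \<dots> = \<one>\<^bsub>G\<^esub>"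
      unfolding G_def
      using hom_one[OF hom_induced_hom group_relative_homology_group group_relative_homology_group] .
    finally show "hom_induced n (top_of_set \<Omega>) (\<Omega> - Z) euclidean (- {0}) \<phi> y =
        hom_induced n euclidean (- cball 0 r) euclidean (- {0}) id x [^]\<^bsub>G\<^esub> (0::int)"
      by simp
  qed
  then show False
    using deg brouwer_degree_ex1[OF deg(1)] by (metis brouwer_degree_def the1_equality)
qed

text \<open>The segment from \<open>d\<close> to \<open>d + v\<close> is connected, so leaving
  \<open>S\<close> would force it to meet the frontier at distance at most \<open>norm v\<close>
  from \<open>d\<close>. An empty frontier is covered by the infinite distance.\<close>

lemma mem_of_dist_frontier:
  fixes S :: "'a::real_normed_vector set"
  assumes "d \<in> S" and v: "ereal (norm v) < edist_to_set d (frontier S)"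
  shows "d + v \<in> S"
proof (rule ccontr)
  assume "d + v \<notin> S"
  then have "closed_segment d (d + v) \<inter> frontier S \<noteq> {}"
    using \<open>d \<in> S\<close> by (intro connected_Int_frontier) auto
  then obtain s where s: "s \<in> closed_segment d (d + v)" "s \<in> frontier S" by blast
  have "edist_to_set d (frontier S) \<le> ereal (dist d s)"
    unfolding edist_to_set_def using s(2) by (rule INF_lower)
  also have "dist d s \<le> norm v"
    using segment_bound(1)[OF s(1)] by (simp add: dist_norm norm_minus_commute)
  finally show False using v by simp
qed

section \<open>Asymptotics of weakly homogeneous mappings\<close>

text \<open>Homogeneity moves the normalisation into the argument of \<open>h\<close>, where
  continuity applies, and the remainder is negligible against
  \<open>norm (x n) powr \<delta>\<close>. The bounded factor \<open>c n\<close> allows the homotopy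
  parameter to vary along the sequence.\<close>

lemma weakly_homogeneous_normalized_limit:
  fixes x :: "nat \<Rightarrow> 'a::real_normed_vector" and c :: "nat \<Rightarrow> real"
  assumes wh: "weakly_homogeneous D \<delta> \<phi> h" and D: "closed D" "convex_cone D"
    and xD: "\<And>n. x n \<in> D" and x_pos: "\<And>n. norm (x n) > 0"
    and x_top: "filterlim (\<lambda>n. norm (x n)) at_top sequentially"
    and x_dir: "(\<lambda>n. x n /\<^sub>R norm (x n)) \<longlonglongrightarrow> u"
    and c: "\<And>n. c n \<in> {0..1}"
  shows "u \<in> D"
    and "(\<lambda>n. (h (x n) + c n *\<^sub>R (\<phi> (x n) - h (x n))) /\<^sub>R (norm (x n) powr \<delta>)) \<longlonglongrightarrow> h u"
proof -
  obtain e where h: "continuous_on D h" "\<And>x t. x \<in> D \<Longrightarrow> t > 0 \<Longrightarrow> h (t *\<^sub>R x) = (t powr \<delta>) *\<^sub>R h x"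
    and e: "\<And>x. x \<in> D \<Longrightarrow> \<phi> x = h x + e x"
    and e0: "((\<lambda>x. e x /\<^sub>R (norm x powr \<delta>)) \<longlongrightarrow> 0) (inf at_infinity (principal D))"
    using wh unfolding weakly_homogeneous_def pos_homogeneous_def by auto
  have dirD: "x n /\<^sub>R norm (x n) \<in> D" for n
    using convex_cone_scaleR[OF D(2) _ xD[of n]] by simp
  show u: "u \<in> D"
    by (rule Lim_in_closed_set[OF D(1) _ _ x_dir]) (use dirD in auto)
  have "filterlim x (inf at_infinity (principal D)) sequentially"
    using x_top xD by (simp add: filterlim_inf filterlim_principal filterlim_at_infinity_conv_norm_at_top)
  from filterlim_compose[OF e0 this]
  have e_lim: "(\<lambda>n. e (x n) /\<^sub>R (norm (x n) powr \<delta>)) \<longlonglongrightarrow> 0" .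
  have "(\<lambda>n. c n *\<^sub>R (e (x n) /\<^sub>R (norm (x n) powr \<delta>))) \<longlonglongrightarrow> 0"
    by (rule Lim_null_comparison[OF _ tendsto_norm_zero[OF e_lim]])
       (use c in \<open>auto intro!: always_eventually mult_left_le_one_le simp: mult.assoc\<close>)
  moreover have "(\<lambda>n. h (x n /\<^sub>R norm (x n))) \<longlonglongrightarrow> h u"
    by (rule continuous_on_tendsto_compose[OF h(1) x_dir u]) (use dirD in auto)
  ultimately have "(\<lambda>n. h (x n /\<^sub>R norm (x n)) + c n *\<^sub>R (e (x n) /\<^sub>R (norm (x n) powr \<delta>))) \<longlonglongrightarrow> h u + 0"
    by (intro tendsto_add)
  moreover have "h (x n /\<^sub>R norm (x n)) + c n *\<^sub>R (e (x n) /\<^sub>R (norm (x n) powr \<delta>)) =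
      (h (x n) + c n *\<^sub>R (\<phi> (x n) - h (x n))) /\<^sub>R (norm (x n) powr \<delta>)" for n
  proof -
    have "h (x n /\<^sub>R norm (x n)) = h (x n) /\<^sub>R (norm (x n) powr \<delta>)"
      using h(2)[OF xD, of "inverse (norm (x n))" n] x_pos[of n] by (simp add: inverse_powr)
    then show ?thesis using e[OF xD, of n] by (simp add: scaleR_add_right)
  qed
  ultimately show "(\<lambda>n. (h (x n) + c n *\<^sub>R (\<phi> (x n) - h (x n))) /\<^sub>R (norm (x n) powr \<delta>)) \<longlonglongrightarrow> h u"
    by simp
qed

section \<open>The homotopy\<close>

text \<open>Condition (a) is the case \<open>c = (\<lambda>_. 1)\<close>, and condition (b) the case \<open>c = (\<lambda>t. t)\<close>.\<close>

lemma ex_SOL_of_degree: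
  fixes C K :: "'a::euclidean_space set" and c :: "real \<Rightarrow> real"
  assumes C: "closed C" "convex_cone C"
    and K: "K \<noteq> {}" "closed K" "convex K" "K \<subseteq> C"
    and f_wh: "weakly_homogeneous C \<delta>1 f f_inf"
    and g_wh: "weakly_homogeneous UNIV \<delta>2 g g_inf"
    and F: "continuous_on UNIV F" "\<And>x. x \<in> C \<Longrightarrow> f x = F x + P"
    and F_inf: "continuous_on UNIV F_inf" "\<And>x. x \<in> C \<Longrightarrow> F_inf x = f_inf x"
    and g_preimage: "\<And>x. g x \<in> C \<Longrightarrow> x \<in> C"
    and g_far: "\<forall>\<^sub>F x in at_infinity. g x - g_inf x \<in> C"
    and c: "continuous_on {0..1} c" "c \<in> {0..1} \<rightarrow> {0..1}" "c 1 = 1"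
  defines "G \<equiv> \<lambda>t x. g_inf x + c t *\<^sub>R (g x - g_inf x)"
    and "E \<equiv> \<lambda>t x. F_inf x + c t *\<^sub>R (F x - F_inf x)"
  assumes G0: "\<And>x. G 0 x \<in> recession_cone K \<Longrightarrow> x \<in> C"
    and d: "d \<in> dual_cone (recession_cone K)"
    and SOL_inf: "SOL C f_inf g_inf (recession_cone K) \<subseteq> {0}"
    and SOL_0: "SOL C (\<lambda>x. E 0 x + d) (G 0) (recession_cone K) \<subseteq> {0}"
    and near: "\<And>x. x \<in> \<Omega> \<Longrightarrow> ereal (dist (E 0 x) (G 0 x)) < edist_to_set d (frontier (dual_cone (recession_cone K)))"
    and deg: "brouwer_degree_defined (G 0) \<Omega> 0" "brouwer_degree (G 0) \<Omega> 0 \<noteq> 0"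
  shows "\<exists>x. x \<in> SOL C f g K"
proof -
  let ?R = "recession_cone K"
  note K3 = K(1-3)
  \<comment> \<open>At \<open>t = 0\<close> this is \<open>E 0\<close> shifted by \<open>d\<close>;
    at \<open>t = 1\<close>, since \<open>c 1 = 1\<close>, it is \<open>F + P\<close>, which is
    \<open>f\<close> on \<open>C\<close>.\<close>
  define H where "H = (\<lambda>t x. E t x + (1 - t) *\<^sub>R d + t *\<^sub>R P)"
  define \<Phi> where "\<Phi> = (\<lambda>t x. G t x - closest_point (homothet K t) (G t x - H t x))"
  have R0: "0 \<in> ?R" using convex_cone_contains_0[OF convex_cone_recession_cone[OF K3]] .
  have c01: "c t \<in> {0..1}" if "t \<in> {0..1}" for t using c(2) that by auto
  obtain w where w: "w \<in> K" using K by auto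

  \<comment> \<open>A zero of the natural map says that \<open>G t x\<close> is its own projection
    after the step \<open>- H t x\<close>, which is the variational inequality on the
    homothet.\<close>
  have zero_iff: "\<Phi> t x = 0 \<longleftrightarrow> G t x \<in> homothet K t \<and> (\<forall>y\<in>homothet K t. 0 \<le> H t x \<bullet> (y - G t x))"
    if "t \<in> {0..1}" for t x
  proof -
    have "homothet K t \<noteq> {}" using homothet_nonempty[OF K3] that by simp
    from closest_point_eq_iff[OF this closed_homothet[OF K(2)] convex_homothet[OF K(3)], of "G t x - H t x" "G t x"]
    show ?thesis by (auto simp: \<Phi>_def)
  qed

  have cont: "continuous_on ({0..1} \<times> UNIV) (\<lambda>(t, x). \<Phi> t x)"
  proof -
    have "continuous_on UNIV g_inf" "continuous_on UNIV g"
      using g_wh by (auto simp: weakly_homogeneous_def pos_homogeneous_def intro!: continuous_on_add cong: continuous_on_cong)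
    then have "continuous_on ({0..1} \<times> UNIV) (\<lambda>z. g_inf (snd z))" "continuous_on ({0..1} \<times> UNIV) (\<lambda>z. g (snd z))"
      by (auto intro!: continuous_on_compose2[of UNIV _ _ snd] continuous_intros)
    moreover have "continuous_on ({0..1} \<times> (UNIV::'a set)) (\<lambda>z. c (fst z))"
      by (rule continuous_on_compose2[OF c(1)]) (auto intro!: continuous_intros)
    moreover have "continuous_on ({0..1} \<times> UNIV) (\<lambda>z. F (snd z))" "continuous_on ({0..1} \<times> UNIV) (\<lambda>z. F_inf (snd z))"
      using F(1) F_inf(1) by (auto intro!: continuous_on_compose2[of UNIV _ _ snd] continuous_intros)
    ultimately have GH: "continuous_on ({0..1} \<times> UNIV) (\<lambda>z. G (fst z) (snd z))"
      "continuous_on ({0..1} \<times> UNIV) (\<lambda>z. H (fst z) (snd z))"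
      unfolding G_def H_def E_def by (auto intro!: continuous_intros)
    have "continuous_on ({0..1} \<times> UNIV)
        (\<lambda>z. (\<lambda>(t, z). closest_point (homothet K t) z) (fst z, G (fst z) (snd z) - H (fst z) (snd z)))"
      by (rule continuous_on_compose2[OF continuous_on_closest_point_homothet[OF K3]])
         (auto intro!: continuous_intros GH)
    then show ?thesis
      using GH by (auto simp: \<Phi>_def case_prod_beta intro!: continuous_on_diff)
  qed

  obtain N where N: "\<And>x. norm x \<ge> N \<Longrightarrow> g x - g_inf x \<in> C"
    using g_far by (auto simp: eventually_at_infinity)
  \<comment> \<open>Only on \<open>C\<close> are the extensions tied to \<open>f\<close> and
    \<open>f_inf\<close>. Adding the missing part of the remainder, which lies in the cone
    \<open>C\<close> far out, turns \<open>G t x\<close> into \<open>g x\<close>, and the preimage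
    condition then gives \<open>x\<close> in \<open>C\<close>.\<close>
  have far_C: "x \<in> C" if "t \<in> {0..1}" "\<Phi> t x = 0" "norm x \<ge> N" for t x
  proof -
    have "G t x \<in> C"
      using zero_iff[OF that(1)] that homothet_subset[OF K3 C K(4)] by auto
    moreover have "(1 - c t) *\<^sub>R (g x - g_inf x) \<in> C"
      using N[OF that(3)] c01[OF that(1)] C(2) by (intro convex_cone_scaleR) auto
    ultimately have "G t x + (1 - c t) *\<^sub>R (g x - g_inf x) \<in> C" by (rule convex_cone_add[OF C(2)])
    then have "g x \<in> C" by (simp add: G_def algebra_simps)
    then show ?thesis by (rule g_preimage)
  qed

  \<comment> \<open>The a priori bound. Along unbounded zeros the directions converge to a unit
    vector \<open>u\<close>. Dividing \<open>G\<close> by \<open>\<rho>2\<close> and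
    \<open>H\<close> by \<open>\<rho>1\<close> separately, as the degrees may differ, shows that
    \<open>u\<close> solves the leading-term problem.\<close>
  have "\<exists>M. \<forall>t\<in>{0..1}. \<forall>x. \<Phi> t x = 0 \<longrightarrow> norm x \<le> M"
  proof (rule ccontr)
    assume "\<not> ?thesis"
    then have "\<exists>t x. t \<in> {0..1} \<and> \<Phi> t x = 0 \<and> norm x > real n + \<bar>N\<bar>" for n
      by (meson not_le)
    then obtain t x where tx: "\<And>n. t n \<in> {0..1}" "\<And>n. \<Phi> (t n) (x n) = 0" "\<And>n. norm (x n) > real n + \<bar>N\<bar>"
      by metis
    have "norm (x n) > 0" for n using tx(3)[of n] by linarith
    then have "\<forall>n. x n /\<^sub>R norm (x n) \<in> sphere 0 1" by auto
    with compact_sphere[of "0::'a" 1, unfolded compact_def] obtain u r where r: "strict_mono r" and u: "u \<in> sphere 0 1"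
      and lim: "((\<lambda>n. x n /\<^sub>R norm (x n)) \<circ> r) \<longlonglongrightarrow> u"
      by (elim allE[of _ "\<lambda>n. x n /\<^sub>R norm (x n)"]) blast
    define y s where "y n = x (r n)" and "s n = t (r n)" for n
    have s: "s n \<in> {0..1}" and y0: "\<Phi> (s n) (y n) = 0" and y_norm: "norm (y n) > real n + \<bar>N\<bar>" for n
      using tx[of "r n"] seq_suble[OF r, of n] by (auto simp: y_def s_def)
    have yC: "y n \<in> C" and y_pos: "norm (y n) > 0" for n
      using far_C[OF s y0] y_norm[of n] by auto
    have "real n \<le> norm (y n)" for n using y_norm[of n] by linarith
    then have y_top: "filterlim (\<lambda>n. norm (y n)) at_top sequentially"
      by (intro filterlim_at_top_mono[OF filterlim_real_sequentially] always_eventually) auto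
    have y_dir: "(\<lambda>n. y n /\<^sub>R norm (y n)) \<longlonglongrightarrow> u" using lim by (simp add: y_def o_def)
    have \<delta>: "\<delta>1 > 0" "\<delta>2 > 0" using f_wh g_wh by (auto simp: weakly_homogeneous_def)
    have powr_top: "filterlim (\<lambda>n. norm (y n) powr \<delta>) at_top sequentially" if "\<delta> > 0" for \<delta>
      using filterlim_compose[OF real_powr_at_top[OF that] y_top] .
    define \<rho>1 \<rho>2 where "\<rho>1 n = norm (y n) powr \<delta>1" and "\<rho>2 n = norm (y n) powr \<delta>2" for n
    have \<rho>_pos: "\<rho>1 n > 0" "\<rho>2 n > 0" for n using y_pos[of n] by (auto simp: \<rho>1_def \<rho>2_def)
    have small: "(\<lambda>n. a n / \<rho> n) \<longlonglongrightarrow> 0"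
      if "\<And>n. \<bar>a n\<bar> \<le> b" "filterlim \<rho> at_top sequentially" for a \<rho> :: "nat \<Rightarrow> real" and b
    proof (rule tendsto_0_le)
      show "(\<lambda>n. b / \<rho> n) \<longlonglongrightarrow> 0" using real_tendsto_divide_at_top[OF tendsto_const that(2)] .
      show "\<forall>\<^sub>F n in sequentially. norm (a n / \<rho> n) \<le> norm (b / \<rho> n) * 1"
        using that(1) by (intro always_eventually allI) (auto intro!: divide_right_mono intro: order_trans[OF _ abs_ge_self])
    qed
    have \<rho>_top: "filterlim \<rho>1 at_top sequentially" "filterlim \<rho>2 at_top sequentially"
      using powr_top \<delta> by (simp_all add: \<rho>1_def[abs_def] \<rho>2_def[abs_def])
    note c_s = c01[OF s]
    have uC: "u \<in> C"
      by (rule weakly_homogeneous_normalized_limit(1)[OF f_wh C yC y_pos y_top y_dir c_s])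
    have limG: "(\<lambda>n. G (s n) (y n) /\<^sub>R \<rho>2 n) \<longlonglongrightarrow> g_inf u"
      unfolding G_def \<rho>2_def
      by (rule weakly_homogeneous_normalized_limit(2)[OF g_wh _ _ _ y_pos y_top y_dir c_s]) (auto simp: convex_cone_iff)
    have limH: "(\<lambda>n. H (s n) (y n) /\<^sub>R \<rho>1 n) \<longlonglongrightarrow> f_inf u"
    proof -
      have "(\<lambda>n. (f_inf (y n) + c (s n) *\<^sub>R (f (y n) - f_inf (y n))) /\<^sub>R \<rho>1 n) \<longlonglongrightarrow> f_inf u"
        unfolding \<rho>1_def
        by (rule weakly_homogeneous_normalized_limit(2)[OF f_wh C yC y_pos y_top y_dir c_s])
      moreover have "\<bar>s n - c (s n)\<bar> \<le> 1" "\<bar>1 - s n\<bar> \<le> 1" for n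
        using s[of n] c_s[of n] by auto
      then have "(\<lambda>n. ((s n - c (s n)) / \<rho>1 n) *\<^sub>R P + ((1 - s n) / \<rho>1 n) *\<^sub>R d) \<longlonglongrightarrow> 0 *\<^sub>R P + 0 *\<^sub>R d"
        by (intro tendsto_intros small[where b = 1] \<rho>_top) auto
      ultimately have "(\<lambda>n. (f_inf (y n) + c (s n) *\<^sub>R (f (y n) - f_inf (y n))) /\<^sub>R \<rho>1 n +
          (((s n - c (s n)) / \<rho>1 n) *\<^sub>R P + ((1 - s n) / \<rho>1 n) *\<^sub>R d)) \<longlonglongrightarrow> f_inf u + (0 *\<^sub>R P + 0 *\<^sub>R d)"
        by (rule tendsto_add)
      moreover have "H (s n) (y n) /\<^sub>R \<rho>1 n = (f_inf (y n) + c (s n) *\<^sub>R (f (y n) - f_inf (y n))) /\<^sub>R \<rho>1 n +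
          (((s n - c (s n)) / \<rho>1 n) *\<^sub>R P + ((1 - s n) / \<rho>1 n) *\<^sub>R d)" for n
      proof -
        \<comment> \<open>On \<open>C\<close>, \<open>F\<close> is \<open>f - P\<close>; what is
          left over besides the leading and remainder terms is bounded and vanishes after division
          by \<open>\<rho>1\<close>.\<close>
        have "H (s n) (y n) = f_inf (y n) + c (s n) *\<^sub>R (f (y n) - f_inf (y n)) +
            ((s n - c (s n)) *\<^sub>R P + (1 - s n) *\<^sub>R d)"
          using F(2)[OF yC, of n] F_inf(2)[OF yC, of n] by (simp add: H_def E_def algebra_simps)
        then show ?thesis by (simp add: scaleR_add_right divide_inverse mult.commute)
      qed
      ultimately show ?thesis by simp
    qed
    have VI: "G (s n) (y n) \<in> homothet K (s n)" "\<And>z. z \<in> homothet K (s n) \<Longrightarrow> 0 \<le> H (s n) (y n) \<bullet> (z - G (s n) (y n))" for n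
      using zero_iff[OF s] y0 by auto
    have "g_inf u \<in> ?R"
    proof -
      \<comment> \<open>Membership of \<open>G\<close> in the homothet is used with the step
        \<open>a / \<rho>2 n\<close>, eventually admissible because \<open>s n <= 1\<close> and
        \<open>\<rho>2 n >= a\<close>.\<close>
      have "z + a *\<^sub>R g_inf u \<in> K" if z: "z \<in> K" and a: "a \<ge> 0" for z a
      proof (rule Lim_in_closed_set[OF K(2)])
        have "(\<lambda>n. z + a *\<^sub>R (G (s n) (y n) /\<^sub>R \<rho>2 n - (s n / \<rho>2 n) *\<^sub>R z)) \<longlonglongrightarrow> z + a *\<^sub>R (g_inf u - 0 *\<^sub>R z)"
          by (intro tendsto_intros limG small[where b = 1] \<rho>_top) (use s in auto)
        then show "(\<lambda>n. z + (a / \<rho>2 n) *\<^sub>R (G (s n) (y n) - s n *\<^sub>R z)) \<longlonglongrightarrow> z + a *\<^sub>R g_inf u"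
          by (simp add: scaleR_diff_right divide_inverse mult.commute mult.left_commute)
        have "\<forall>\<^sub>F n in sequentially. \<rho>2 n \<ge> a" using \<rho>_top(2) by (simp add: filterlim_at_top)
        then show "\<forall>\<^sub>F n in sequentially. z + (a / \<rho>2 n) *\<^sub>R (G (s n) (y n) - s n *\<^sub>R z) \<in> K"
        proof eventually_elim
          case (elim n)
          have "a / \<rho>2 n * s n \<le> 1 * 1"
            by (rule mult_mono) (use elim a s[of n] \<rho>_pos(2)[of n] in \<open>auto simp: divide_simps\<close>)
          then show ?case using VI(1)[of n] z a \<rho>_pos(2)[of n] by (auto simp: homothet_def)
        qed
      qed simp
      then show ?thesis by (simp add: recession_cone_eq[OF K3])
    qed
    \<comment> \<open>The test vector \<open>s n w + \<rho>2 n z\<close> belongs to the homothet.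
      After division by \<open>\<rho>1 n\<close> and \<open>\<rho>2 n\<close> its component along
      \<open>w\<close> disappears in the limit.\<close>
    moreover have "0 \<le> f_inf u \<bullet> (z - g_inf u)" if z: "z \<in> ?R" for z
    proof (rule LIMSEQ_le_const)
      have "(\<lambda>n. (H (s n) (y n) /\<^sub>R \<rho>1 n) \<bullet> ((s n / \<rho>2 n) *\<^sub>R w + z - G (s n) (y n) /\<^sub>R \<rho>2 n)) \<longlonglongrightarrow>
          f_inf u \<bullet> (0 *\<^sub>R w + z - g_inf u)"
        by (intro tendsto_intros limG limH small[where b = 1] \<rho>_top) (use s in auto)
      then show "(\<lambda>n. (H (s n) (y n) /\<^sub>R \<rho>1 n) \<bullet> ((s n / \<rho>2 n) *\<^sub>R w + z - G (s n) (y n) /\<^sub>R \<rho>2 n)) \<longlonglongrightarrow>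
          f_inf u \<bullet> (z - g_inf u)" by simp
      have "0 \<le> (H (s n) (y n) /\<^sub>R \<rho>1 n) \<bullet> ((s n / \<rho>2 n) *\<^sub>R w + z - G (s n) (y n) /\<^sub>R \<rho>2 n)" for n
      proof -
        have "\<rho>2 n *\<^sub>R z \<in> ?R"
          using convex_cone_scaleR[OF convex_cone_recession_cone[OF K3]] z \<rho>_pos(2)[of n] by simp
        then have "s n *\<^sub>R w + \<rho>2 n *\<^sub>R z \<in> homothet K (s n)"
          using homothet_add_recession[OF K3 _ w] s[of n] by simp
        then have "0 \<le> H (s n) (y n) \<bullet> (s n *\<^sub>R w + \<rho>2 n *\<^sub>R z - G (s n) (y n))" using VI(2) by blast
        moreover have "s n *\<^sub>R w + \<rho>2 n *\<^sub>R z - G (s n) (y n) =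
            \<rho>2 n *\<^sub>R ((s n / \<rho>2 n) *\<^sub>R w + z - G (s n) (y n) /\<^sub>R \<rho>2 n)"
          using \<rho>_pos(2)[of n] by (simp add: algebra_simps)
        ultimately show ?thesis
          using \<rho>_pos[of n] by (simp add: zero_le_mult_iff)
      qed
      then show "\<exists>N. \<forall>n\<ge>N. 0 \<le> (H (s n) (y n) /\<^sub>R \<rho>1 n) \<bullet> ((s n / \<rho>2 n) *\<^sub>R w + z - G (s n) (y n) /\<^sub>R \<rho>2 n)"
        by blast
    qed
    ultimately have "u \<in> SOL C f_inf g_inf ?R" using uC by (simp add: SOL_def)
    then show False using SOL_inf u by auto
  qed
  then obtain M where M: "\<And>t x. t \<in> {0..1} \<Longrightarrow> \<Phi> t x = 0 \<Longrightarrow> norm x \<le> M" by blast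

  \<comment> \<open>Here \<open>H 0 x - G 0 x = d + (E 0 x - G 0 x)\<close> stays in the dual cone,
    so its negative projects to 0 on the recession cone.\<close>
  have \<Phi>0_\<Omega>: "\<Phi> 0 x = G 0 x" if x: "x \<in> \<Omega>" for x
  proof -
    have "d + (E 0 x - G 0 x) \<in> dual_cone ?R"
      using mem_of_dist_frontier[OF d] near[OF x] by (simp add: dist_norm)
    then have "closest_point (homothet K 0) (G 0 x - H 0 x) = 0"
      using R0 by (subst closest_point_eq_iff)
        (auto simp: homothet_0[OF K3] H_def dual_cone_def closed_recession_cone[OF K3] inner_diff_left inner_add_left
          intro: convex_cone_recession_cone[OF K3, unfolded convex_cone_def, THEN conjunct2, THEN conjunct1])
    then show ?thesis by (simp add: \<Phi>_def)
  qed
  have \<Phi>0_zero: "x = 0" if "\<Phi> 0 x = 0" for x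
  proof -
    have "x \<in> SOL C (\<lambda>x. E 0 x + d) (G 0) ?R"
      using that zero_iff[of 0 x] G0[of x] by (auto simp: SOL_def H_def homothet_0[OF K3])
    then show ?thesis using SOL_0 by auto
  qed
  \<comment> \<open>Nonzero degree gives a zero of \<open>G 0\<close> in \<open>\<Omega>\<close>. It
    is a zero of \<open>\<Phi> 0\<close> too, hence equals 0; thus 0 lies in
    \<open>\<Omega>\<close>, and no other zero of \<open>\<Phi> 0\<close> exists.\<close>
  obtain z where z: "z \<in> \<Omega>" "G 0 z = 0"
    using brouwer_degree_eq_0[OF deg(1)] deg(2) by (metis imageE)
  then have \<Phi>0_zero_\<Omega>: "x \<in> \<Omega>" if "\<Phi> 0 x = 0" for x
    using that \<Phi>0_\<Omega> \<Phi>0_zero by metis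
  have "\<exists>x. \<Phi> 1 x = 0"
    by (rule exists_zero_of_homotopy_degree[OF cont _ deg]) (fact M \<Phi>0_\<Omega> \<Phi>0_zero_\<Omega>)+
  then obtain x where x: "\<Phi> 1 x = 0" ..
  have "G 1 x \<in> K" and VI: "\<And>y. y \<in> K \<Longrightarrow> 0 \<le> H 1 x \<bullet> (y - G 1 x)"
    using x zero_iff[of 1 x] homothet_1[OF K(1,3)] by auto
  then have gx: "g x \<in> K" by (simp add: G_def c)
  then have "x \<in> C" using K(4) g_preimage by blast
  moreover have "H 1 x = f x" using F(2)[OF \<open>x \<in> C\<close>] by (simp add: H_def E_def c)
  ultimately show ?thesis using gx VI by (auto simp: SOL_def G_def c)
qed

section \<open>Complementarity form, uniqueness, and the proof of the theorem\<close>

text \<open>Testing with \<open>\<psi> x + y\<close> gives membership in the dual cone, and testing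
  with 0 gives orthogonality.\<close>

lemma SOL_convex_cone_eq_GCP_SOL:
  assumes S: "convex_cone S"
  shows "SOL D \<phi> \<psi> S = GCP_SOL D \<phi> \<psi> S"
proof (intro subset_antisym subsetI)
  fix x assume x: "x \<in> SOL D \<phi> \<psi> S"
  then have xD: "x \<in> D" "\<psi> x \<in> S" and VI: "\<And>y. y \<in> S \<Longrightarrow> 0 \<le> \<phi> x \<bullet> (y - \<psi> x)"
    by (auto simp: SOL_def)
  have "0 \<le> \<phi> x \<bullet> y" if "y \<in> S" for y
    using VI[OF convex_cone_add[OF S xD(2) that]] by simp
  moreover have "\<phi> x \<bullet> \<psi> x \<le> 0" using VI[OF convex_cone_contains_0[OF S]] by simp
  ultimately show "x \<in> GCP_SOL D \<phi> \<psi> S"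
    using xD by (auto simp: GCP_SOL_def dual_cone_def intro: antisym)
next
  fix x assume "x \<in> GCP_SOL D \<phi> \<psi> S"
  then show "x \<in> SOL D \<phi> \<psi> S" by (auto simp: GCP_SOL_def SOL_def dual_cone_def inner_diff_right)
qed

text \<open>Each inequality is tested with the other solution; their sum contradicts strict
  monotonicity.\<close>

lemma SOL_unique:
  assumes "strictly_monotone_wrt D f g S" "x \<in> SOL D f g S" "y \<in> SOL D f g S"
  shows "x = y"
proof (rule ccontr)
  assume "x \<noteq> y"
  then have "0 < (f x - f y) \<bullet> (g x - g y)"
    using assms by (auto simp: strictly_monotone_wrt_def SOL_def)
  moreover have "0 \<le> f x \<bullet> (g y - g x)" "0 \<le> f y \<bullet> (g x - g y)"
    using assms by (auto simp: SOL_def)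
  ultimately show False by (simp add: inner_diff_left inner_diff_right)
qed

theorem mainTheorem9:
  fixes C K :: "'a::euclidean_space set"
    and f f_inf f_bar g g_inf g_bar F F_inf :: "'a \<Rightarrow> 'a"
    and p q d :: 'a
    and \<delta>1 \<delta>2 :: real
  assumes C: "closed C" "convex_cone C"
    and K: "K \<noteq> {}" "closed K" "convex K" "K \<subseteq> C"
    and K_pointed: "pointed (recession_cone K)"
    and f_wh: "weakly_homogeneous C \<delta>1 f f_inf"
    and f_decomp: "\<forall>x\<in>C. f x = f_inf x + f_bar x + p"
    and g_wh: "weakly_homogeneous UNIV \<delta>2 g g_inf"
    and g_decomp: "\<forall>x. g x = g_inf x + g_bar x + q"
    and F: "continuous_on UNIV F" "\<forall>x\<in>C. F x = f_inf x + f_bar x - f_bar 0"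
    and F_inf: "continuous_on UNIV F_inf" "\<forall>x\<in>C. F_inf x = f_inf x"
    and g_preimage: "g -` C \<subseteq> C"
    and g_bar_in: "\<forall>\<^sub>F x in at_infinity. g_bar x + q \<in> C"
    and d: "d \<in> interior (dual_cone (recession_cone K))"
    and cond:
      "(SOL C f_inf g_inf (recession_cone K) = {0} \<and>
        SOL C (\<lambda>x. f_inf x + f_bar x - f_bar 0 + d) g (recession_cone K) = {0} \<and>
        (\<exists>\<Omega>. \<Omega> \<noteq> {} \<and> bounded \<Omega> \<and> open \<Omega> \<and>
          (\<forall>x\<in>\<Omega>. ereal (dist (F x) (g x))
                    < edist_to_set d (frontier (dual_cone (recession_cone K)))) \<and>
          brouwer_degree_defined g \<Omega> 0 \<and> brouwer_degree g \<Omega> 0 \<noteq> 0))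
       \<or>
       (SOL C f_inf g_inf (recession_cone K) = {0} \<and>
        SOL C (\<lambda>x. f_inf x + d) g_inf (recession_cone K) = {0} \<and>
        (\<exists>\<Omega>. \<Omega> \<noteq> {} \<and> bounded \<Omega> \<and> open \<Omega> \<and>
          (\<forall>x\<in>\<Omega>. ereal (dist (F_inf x) (g_inf x))
                    < edist_to_set d (frontier (dual_cone (recession_cone K)))) \<and>
          brouwer_degree_defined g_inf \<Omega> 0 \<and> brouwer_degree g_inf \<Omega> 0 \<noteq> 0))"
  shows "(strictly_monotone_wrt C f g K \<longrightarrow> (\<exists>!x. x \<in> SOL C f g K)) \<and>
         (strictly_monotone_wrt C f g (recession_cone K) \<longrightarrow>
            (\<exists>!x. x \<in> GCP_SOL C f g (recession_cone K)))"
proof -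
  let ?R = "recession_cone K"
  have R: "convex_cone ?R" "closed ?R" "?R \<subseteq> C" "recession_cone ?R = ?R"
    using convex_cone_recession_cone[OF K(1-3)] closed_recession_cone[OF K(1-3)]
      recession_cone_subset[OF K(1-3) C K(4)] recession_cone_convex_cone by auto
  have g_far: "\<forall>\<^sub>F x in at_infinity. g x - g_inf x \<in> C"
    using g_bar_in by (rule eventually_mono) (simp add: g_decomp add.assoc)
  \<comment> \<open>\<open>F\<close> extends \<open>f\<close> without its value at 0, so the
    constant \<open>P\<close> of the homotopy is \<open>f_bar 0 + p\<close>.\<close>
  have f_F: "f x = F x + (f_bar 0 + p)" if "x \<in> C" for x
    using that f_decomp F(2) by (simp add: algebra_simps)
  \<comment> \<open>Condition (b) starts the homotopy at \<open>g_inf\<close>, so the preimage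
    condition has to pass from \<open>g\<close> to \<open>g_inf\<close>. Scaling \<open>x\<close> to
    norm \<open>\<bar>N\<bar> + 1\<close> makes the remainder a member of \<open>C\<close>; adding
    it gives \<open>g (t x)\<close> in \<open>C\<close>, and \<open>x\<close> is recovered by
    scaling back.\<close>
  have g_inf_preimage: "x \<in> C" if x: "g_inf x \<in> C" for x
  proof (cases "x = 0")
    case True then show ?thesis using convex_cone_contains_0[OF C(2)] by simp
  next
    case False
    obtain N where N: "\<And>x. norm x \<ge> N \<Longrightarrow> g x - g_inf x \<in> C"
      using g_far by (auto simp: eventually_at_infinity)
    define t where "t = (\<bar>N\<bar> + 1) / norm x"
    have t: "t > 0" "norm (t *\<^sub>R x) \<ge> N" using False by (auto simp: t_def)
    have "g_inf (t *\<^sub>R x) = (t powr \<delta>2) *\<^sub>R g_inf x"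
      using g_wh t by (simp add: weakly_homogeneous_def pos_homogeneous_def)
    then have "g_inf (t *\<^sub>R x) \<in> C" using convex_cone_scaleR[OF C(2) _ x] by simp
    then have "g_inf (t *\<^sub>R x) + (g (t *\<^sub>R x) - g_inf (t *\<^sub>R x)) \<in> C"
      using N[OF t(2)] by (rule convex_cone_add[OF C(2)])
    then have "t *\<^sub>R x \<in> C" using g_preimage by auto
    then show ?thesis using convex_cone_scaleR[OF C(2), of "inverse t" "t *\<^sub>R x"] t by simp
  qed
  have SOL_cong: "SOL C \<phi> \<psi> S = SOL C \<phi>' \<psi> S" if "\<And>x. x \<in> C \<Longrightarrow> \<phi> x = \<phi>' x" for \<phi> \<phi>' \<psi> :: "'a \<Rightarrow> 'a" and S
    using that by (auto simp: SOL_def)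
  \<comment> \<open>Conditions (a) and (b) see the constraint set only through its recession cone,
    so one existence argument serves every \<open>S\<close> with the same recession cone.\<close>
  have ex: "\<exists>x. x \<in> SOL C f g S"
    if S: "S \<noteq> {}" "closed S" "convex S" "S \<subseteq> C" and SR: "recession_cone S = ?R" for S
  proof -
    have d': "d \<in> dual_cone (recession_cone S)" using d interior_subset SR by auto
    have pre: "\<And>x. g x \<in> C \<Longrightarrow> x \<in> C" using g_preimage by auto
    note core = ex_SOL_of_degree[OF C S f_wh g_wh F(1) f_F F_inf(1) F_inf(2)[rule_format] pre g_far _ _ _ _ d']
    from cond show ?thesis
    proof (elim disjE conjE exE)
      fix \<Omega> assume a: "SOL C f_inf g_inf ?R = {0}"
        "SOL C (\<lambda>x. f_inf x + f_bar x - f_bar 0 + d) g ?R = {0}"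
        "\<forall>x\<in>\<Omega>. ereal (dist (F x) (g x)) < edist_to_set d (frontier (dual_cone ?R))"
        "brouwer_degree_defined g \<Omega> 0" "brouwer_degree g \<Omega> 0 \<noteq> 0"
      have "SOL C (\<lambda>x. F x + d) g ?R = {0}"
        using SOL_cong[of "\<lambda>x. F x + d" "\<lambda>x. f_inf x + f_bar x - f_bar 0 + d"] F(2) a(2) by simp
      then show ?thesis
        by (intro core[where c = "\<lambda>_. 1" and \<Omega> = \<Omega>])
          (use a pre subsetD[OF R(3)] in \<open>auto simp: SR\<close>)
    next
      fix \<Omega> assume b: "SOL C f_inf g_inf ?R = {0}"
        "SOL C (\<lambda>x. f_inf x + d) g_inf ?R = {0}"
        "\<forall>x\<in>\<Omega>. ereal (dist (F_inf x) (g_inf x)) < edist_to_set d (frontier (dual_cone ?R))"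
        "brouwer_degree_defined g_inf \<Omega> 0" "brouwer_degree g_inf \<Omega> 0 \<noteq> 0"
      have "SOL C (\<lambda>x. F_inf x + d) g_inf ?R = {0}"
        using SOL_cong[of "\<lambda>x. F_inf x + d" "\<lambda>x. f_inf x + d"] F_inf(2) b(2) by simp
      then show ?thesis
        by (intro core[where c = "\<lambda>t. t" and \<Omega> = \<Omega>])
          (use b g_inf_preimage subsetD[OF R(3)] in \<open>auto simp: SR\<close>)
    qed
  qed
  have "\<exists>x. x \<in> SOL C f g K" by (rule ex[OF K refl])
  \<comment> \<open>The cone problem is the instance \<open>S = ?R\<close>, a closed convex cone
    being its own recession cone.\<close>
  moreover have "\<exists>x. x \<in> SOL C f g ?R"
    using R by (intro ex) (auto simp: convex_cone_def)
  ultimately show ?thesis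
    using SOL_unique[of C f g] SOL_convex_cone_eq_GCP_SOL[OF R(1), of C f g] by blast
qed

end
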